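(* Let $p(g\mid\mathbf w)=\sum_{k\in\mathcal A}\theta_kP_{(k)}(w_{-k},g)$ be an imitation kernel on a finite set $G$ with $\gcd(\mathcal A)=1$, and assume the $G$-stochastic function $P_{(\cdot)}$ is irreducible and aperiodic. Then $\mathcal G(p)$ consists of a single law $\mu$, and every single-site marginal of $\mu$ equals $\hat\lambda$, the unique invariant distribution of $\hat P=\sum_{k\in\mathcal A}\theta_kP_{(k)}$.
   Context: $\mathcal A\subset\mathbb N_+$, $\theta$ a probability on $\mathcal A$ with $\theta_k>0$ for $k\in\mathcal A$, $P_{(k)}$ stochastic matrices on $G$, $\mathbf w=(w_{-1},w_{-2},\dots)\in G^{-\mathbb N_+}$. A law of $(X_n)_{n\in\mathbb Z}$ on $G^{\mathbb Z}$ is compatible with $p$ if $P(X_n=g\mid X_{n-1},X_{n-2},\dots)=p(g\mid X_{n-1},X_{n-2},\dots)$ a.s. for all $n\in\mathbb Z$, $g\in G$; $\mathcal G(p)$ is the set of compatible laws. Words $\mathcal A^*=\bigcup_{n\ge1}\mathcal A^n$, $P_{\mathbf a}=P_{(a_n)}\cdots P_{(a_1)}$, depth $s(\mathbf a)=\sum a_i$. $P_{(\cdot)}$ is irreducible if for all $i,j\in G$ some word has $P_{\mathbf a}(i,j)>0$, and aperiodic if moreover $\gcd\{s(\mathbf a):P_{\mathbf a}(i,i)>0\}=1$ for every $i\in G$. *)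

theory Defs
  imports "HOL-Probability.Probability"
begin

definition stochastic :: "('g::finite \<Rightarrow> 'g \<Rightarrow> real) \<Rightarrow> bool" where
  "stochastic Q \<longleftrightarrow> (\<forall>i j. 0 \<le> Q i j) \<and> (\<forall>i. (\<Sum>j\<in>UNIV. Q i j) = 1)"

fun word_mat :: "(nat \<Rightarrow> 'g::finite \<Rightarrow> 'g \<Rightarrow> real) \<Rightarrow> nat list \<Rightarrow> 'g \<Rightarrow> 'g \<Rightarrow> real" where
  "word_mat P [] i j = (if i = j then 1 else 0)"
| "word_mat P (a # as) i j = (\<Sum>x\<in>UNIV. word_mat P as i x * P a x j)"

definition words :: "nat set \<Rightarrow> nat list set" where
  "words A = {a. a \<noteq> [] \<and> set a \<subseteq> A}"

definition irreducible_sf :: "nat set \<Rightarrow> (nat \<Rightarrow> 'g::finite \<Rightarrow> 'g \<Rightarrow> real) \<Rightarrow> bool" where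
  "irreducible_sf A P \<longleftrightarrow> (\<forall>i j. \<exists>a\<in>words A. word_mat P a i j > 0)"

definition aperiodic_sf :: "nat set \<Rightarrow> (nat \<Rightarrow> 'g::finite \<Rightarrow> 'g \<Rightarrow> real) \<Rightarrow> bool" where
  "aperiodic_sf A P \<longleftrightarrow> irreducible_sf A P \<and>
     (\<forall>i. Gcd {sum_list a | a. a \<in> words A \<and> word_mat P a i i > 0} = 1)"

text \<open>Imitation kernel: p(g | w) = sum over k in A of theta_k P_k(w_{-k}, g);
  a past w = (w_{-1}, w_{-2}, ...) is encoded as w :: nat => 'g with w k = w_{-k}
  (the value w 0 is irrelevant).\<close>
definition imitation_kernel ::
  "nat set \<Rightarrow> (nat \<Rightarrow> real) \<Rightarrow> (nat \<Rightarrow> 'g \<Rightarrow> 'g \<Rightarrow> real) \<Rightarrow> 'g \<Rightarrow> (nat \<Rightarrow> 'g) \<Rightarrow> real" where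
  "imitation_kernel A \<theta> P g w = (\<Sum>\<^sub>\<infinity>k\<in>A. \<theta> k * P k (w k) g)"

definition avg_mat :: "nat set \<Rightarrow> (nat \<Rightarrow> real) \<Rightarrow> (nat \<Rightarrow> 'g \<Rightarrow> 'g \<Rightarrow> real) \<Rightarrow> 'g \<Rightarrow> 'g \<Rightarrow> real" where
  "avg_mat A \<theta> P i j = (\<Sum>\<^sub>\<infinity>k\<in>A. \<theta> k * P k i j)"

definition invariant_distr :: "('g::finite \<Rightarrow> 'g \<Rightarrow> real) \<Rightarrow> ('g \<Rightarrow> real) \<Rightarrow> bool" where
  "invariant_distr Q l \<longleftrightarrow> (\<forall>i. 0 \<le> l i) \<and> (\<Sum>i\<in>UNIV. l i) = 1 \<and>
     (\<forall>j. (\<Sum>i\<in>UNIV. l i * Q i j) = l j)"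

definition path_space :: "(int \<Rightarrow> 'g) measure" where
  "path_space = PiM UNIV (\<lambda>_. count_space UNIV)"

definition past_alg :: "int \<Rightarrow> (int \<Rightarrow> 'g) measure" where
  "past_alg n = sigma (space (path_space :: (int \<Rightarrow> 'g) measure))
      {{x \<in> space (path_space :: (int \<Rightarrow> 'g) measure). x m = g} | m g. m < n}"

definition compatible ::
  "('g \<Rightarrow> (nat \<Rightarrow> 'g) \<Rightarrow> real) \<Rightarrow> (int \<Rightarrow> 'g) measure \<Rightarrow> bool" where
  "compatible p \<mu> \<longleftrightarrow> prob_space \<mu> \<and> sets \<mu> = sets path_space \<and>
     (\<forall>n g. AE x in \<mu>. real_cond_exp \<mu> (past_alg n) (indicator {y. y n = g}) x
                        = p g (\<lambda>k. x (n - int k)))"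

end

(* Two compatible laws, one of them possibly shifted in time, are compared through the difference
   D p F of the expectations of F evaluated at the types of finitely many sites p. Resampling the
   latest site from its ancestor expresses D p F as a theta-average of differences at earlier sites,
   as for a system of coalescing ancestral lines. By induction on the number of sites, D vanishes as
   soon as two lines meet or F ignores one line. By pigeonhole one finds, boundedly far below the top
   site, a level t such that every site above t is so far above it that its line visits t exactly,
   with any given pair of end types, with probability bounded below (aperiodicity). Either two lines
   then meet at t, or only the top line is resampled, and a Doeblin minorisation removes a definite
   part of D because D kills functions ignoring that line. Hence the supremum of D contracts strictly
   and is 0; no moment assumption on theta is needed. The same lemma, for one site and the difference
   of two invariant distributions, gives uniqueness of the latter.
   A compatible law is a subsequential limit of the laws started from a fixed past at time -N,
   extended to path space by Kolmogorov's theorem. *)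
theory Submission
  imports Defs "HOL-Complex_Analysis.Great_Picard"
begin

subsection \<open>Return depths\<close>

text \<open>Two features of the argument answer this. The gain comes from types as well as from
  meetings: a line that reaches a fixed level with every pair of end types of positive weight has
  partly forgotten the type at that level, even if it meets no other line. And positivity is used
  only in a bounded range of depths, fixed by the number of lines. Lines that jump over the level
  are not followed further; they end at uncontrolled positions, which is why the difference is
  bounded by a supremum over all positions at once and not for one configuration. Carrying a time
  shift through the comparison yields stationarity along with uniqueness, and stationarity is what
  turns the one-step equation for the marginals into invariance under
  \<open>avg_mat\<close>.\<close>

lemma additive_gcd_one_eventually_mem:
  fixes S :: "nat set"
  assumes add: "\<And>a b. a \<in> S \<Longrightarrow> b \<in> S \<Longrightarrow> a + b \<in> S" and gcd: "Gcd S = 1"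
  shows "\<exists>N. \<forall>n\<ge>N. n \<in> S"
proof -
  define S0 where "S0 = insert 0 S"
  have add0: "a + b \<in> S0" if "a \<in> S0" "b \<in> S0" for a b
    using that add by (auto simp: S0_def)
  have mult0: "n * a \<in> S0" if "a \<in> S0" for n a
  proof (induction n)
    case 0
    then show ?case by (simp add: S0_def)
  next
    case (Suc n)
    then show ?case using add0[OF that Suc] by simp
  qed
  obtain c where c: "c \<in> S" "c > 0"
  proof -
    have "S \<noteq> {}" "S \<noteq> {0}" using gcd by auto
    then show ?thesis using that by blast
  qed
  \<comment> \<open>The least positive difference of two elements stands in for the gcd: dividing
    \<open>x\<close> in \<open>S\<close> by \<open>m\<close> leaves a remainder that is again such a
    difference, so the remainder is 0.\<close>
  define m where "m = (LEAST m. m > 0 \<and> (\<exists>a\<in>S0. \<exists>b\<in>S0. a = b + m))"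
  have ex: "\<exists>m>0. \<exists>a\<in>S0. \<exists>b\<in>S0. a = b + m"
    using c by (intro exI[of _ c]) (auto simp: S0_def)
  from LeastI_ex[OF ex] obtain a b where ab: "m > 0" "a \<in> S0" "b \<in> S0" "a = b + m"
    unfolding m_def by blast
  have m_le: "m \<le> m'" if "m' > 0" "a' \<in> S0" "b' \<in> S0" "a' = b' + m'" for m' a' b'
    unfolding m_def using that by (intro Least_le) blast
  have "m dvd x" if "x \<in> S" for x
  proof (rule ccontr)
    assume "\<not> m dvd x"
    then have r: "x mod m > 0" by (simp add: dvd_eq_mod_eq_0)
    have "x + (x div m) * b = (x div m) * a + x mod m"
      using ab(4) div_mult_mod_eq[of x m] by (simp add: algebra_simps)
    moreover have "x \<in> S0" using that by (simp add: S0_def)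
    then have "x + (x div m) * b \<in> S0" by (intro add0 mult0 ab)
    moreover have "(x div m) * a \<in> S0" by (intro mult0 ab)
    ultimately have "m \<le> x mod m" using m_le[OF r] by blast
    then show False using ab(1) mod_less_divisor[of m x] by linarith
  qed
  then have "m dvd Gcd S" by (rule Gcd_greatest)
  then have a: "a = b + 1" using gcd ab(4) by simp
  \<comment> \<open>With r = n mod b and n div b = r + q one has n = q * b + r * (b + 1), and b, b +
    1 both lie in \<open>S0\<close>. From n \<ge> b * b follows n div b \<ge> b > r, so q exists;
    the extra 1 keeps n away from 0, which \<open>S0\<close> contains by fiat.\<close>
  have "n \<in> S" if n: "n \<ge> b * b + 1" for n
  proof -
    have "n \<in> S0"
    proof (cases "b = 0")
      case True
      then show ?thesis using mult0[OF ab(2), of n] a by simp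
    next
      case False
      then have "n mod b < b" by simp
      have "b \<le> n div b"
        using n False by (metis add_leD1 div_le_mono nonzero_mult_div_cancel_right)
      then obtain q where q: "n div b = n mod b + q"
        using \<open>n mod b < b\<close> by (metis le_Suc_ex less_imp_le_nat order_trans)
      have "n = q * b + (n mod b) * a"
        using div_mult_mod_eq[of n b] unfolding q a by (simp add: algebra_simps)
      then show ?thesis using add0[OF mult0[OF ab(3)] mult0[OF ab(2)]] by metis
    qed
    then show ?thesis using n by (auto simp: S0_def)
  qed
  then show ?thesis by blast
qed

lemma word_mat_nonneg:
  assumes "\<forall>k\<in>A. stochastic (P k)" "set a \<subseteq> A"
  shows "0 \<le> word_mat P a i j"
  using assms(2)
proof (induction a arbitrary: j)
  case (Cons k a)
  then show ?case using assms(1) by (auto intro!: sum_nonneg mult_nonneg_nonneg simp: stochastic_def)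
qed auto

text \<open>The head of a word is its most recent step and multiplies on the right, so in a
  concatenation the second word is traversed first.\<close>

lemma word_mat_append:
  "word_mat P (a @ b) i j = (\<Sum>x\<in>UNIV. word_mat P b i x * word_mat P a x j)"
proof (induction a arbitrary: j)
  case Nil
  then show ?case by (simp add: if_distrib[of "\<lambda>x. _ * x"] cong: if_cong)
next
  case (Cons k a)
  have "word_mat P ((k # a) @ b) i j = (\<Sum>y\<in>UNIV. \<Sum>x\<in>UNIV. word_mat P b i x * (word_mat P a x y * P k y j))"
    by (simp add: Cons sum_distrib_right mult.assoc)
  also have "\<dots> = (\<Sum>x\<in>UNIV. word_mat P b i x * word_mat P (k # a) x j)"
    by (subst sum.swap) (simp add: sum_distrib_left)
  finally show ?case .
qed

lemma word_mat_append_pos: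
  assumes "\<forall>k\<in>A. stochastic (P k)" "set a \<subseteq> A" "set b \<subseteq> A"
    and "word_mat P b i x > 0" "word_mat P a x j > 0"
  shows "word_mat P (a @ b) i j > 0"
  unfolding word_mat_append
  by (rule sum_pos2[where i = x])
     (use assms in \<open>auto intro!: mult_nonneg_nonneg word_mat_nonneg[of A]\<close>)

text \<open>Loop depths at \<open>i\<close> form an additive set with gcd 1, so all large depths
  occur; a loop at \<open>i\<close> followed by one fixed word from \<open>i\<close> to
  \<open>j\<close> then reaches every large depth. Finiteness of the type makes the threshold
  uniform.\<close>

lemma aperiodic_all_depths:
  assumes st: "\<forall>k\<in>A. stochastic (P k)" and ap: "aperiodic_sf A P"
  shows "\<exists>s. \<forall>d\<ge>s. \<forall>i j. \<exists>a. set a \<subseteq> A \<and> sum_list a = d \<and> word_mat P a i j > 0"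
proof -
  have "\<exists>N. \<forall>n\<ge>N. n \<in> {sum_list a | a. a \<in> words A \<and> word_mat P a i i > 0}" for i
  proof (rule additive_gcd_one_eventually_mem)
    show "Gcd {sum_list a | a. a \<in> words A \<and> word_mat P a i i > 0} = 1"
      using ap by (simp add: aperiodic_sf_def)
  next
    fix x y
    assume "x \<in> {sum_list a | a. a \<in> words A \<and> word_mat P a i i > 0}"
      and "y \<in> {sum_list a | a. a \<in> words A \<and> word_mat P a i i > 0}"
    then obtain a b where ab: "x = sum_list a" "a \<in> words A" "word_mat P a i i > 0"
      "y = sum_list b" "b \<in> words A" "word_mat P b i i > 0" by blast
    then have "x + y = sum_list (a @ b)" "a @ b \<in> words A" "word_mat P (a @ b) i i > 0"
      using word_mat_append_pos[OF st] by (auto simp: words_def)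
    then show "x + y \<in> {sum_list a | a. a \<in> words A \<and> word_mat P a i i > 0}" by blast
  qed
  then obtain N where N: "\<And>i n. n \<ge> N i \<Longrightarrow> \<exists>a\<in>words A. sum_list a = n \<and> word_mat P a i i > 0"
    by (auto simp: set_eq_iff) metis
  have "\<forall>i j. \<exists>a\<in>words A. word_mat P a i j > 0"
    using ap by (simp add: aperiodic_sf_def irreducible_sf_def)
  then obtain c where c: "\<And>i j. c i j \<in> words A" "\<And>i j. word_mat P (c i j) i j > 0" by metis
  \<comment> \<open>A crude common upper bound for the finitely many thresholds
    \<open>sum_list (c i j) + N i\<close>.\<close>
  define s where "s = (\<Sum>i\<in>UNIV. \<Sum>j\<in>UNIV. sum_list (c i j) + N i)"
  have s: "sum_list (c i j) + N i \<le> s" for i j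
  proof -
    have "sum_list (c i j) + N i \<le> (\<Sum>j\<in>UNIV. sum_list (c i j) + N i)"
      by (rule member_le_sum) auto
    also have "\<dots> \<le> s" unfolding s_def
      by (rule member_le_sum[where f = "\<lambda>i. \<Sum>j\<in>UNIV. sum_list (c i j) + N i"]) auto
    finally show ?thesis .
  qed
  have "\<exists>a. set a \<subseteq> A \<and> sum_list a = d \<and> word_mat P a i j > 0" if "d \<ge> s" for d i j
  proof -
    have "d - sum_list (c i j) \<ge> N i" using that s[of i j] by linarith
    from N[OF this] obtain b where b: "b \<in> words A" "sum_list b = d - sum_list (c i j)"
      "word_mat P b i i > 0" by blast
    have "sum_list (c i j @ b) = d" using b(2) that s[of i j] by simp
    moreover have "word_mat P (c i j @ b) i j > 0"
      using b c[of i j] by (intro word_mat_append_pos[OF st]) (auto simp: words_def)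
    moreover have "set (c i j @ b) \<subseteq> A" using b c[of i j] by (auto simp: words_def)
    ultimately show ?thesis by blast
  qed
  then show ?thesis by blast
qed

subsection \<open>Matrices acting on functions of finitely many types\<close>

text \<open>Functions of finitely many types are kept as functions of total assignments, with
  locality as a predicate. One type then serves every set of sites, which matters because the
  inductions change that set.\<close>

definition depends_on :: "'i set \<Rightarrow> (('i \<Rightarrow> 'g) \<Rightarrow> 'b) \<Rightarrow> bool" where
  "depends_on I F \<longleftrightarrow> (\<forall>y z. (\<forall>i\<in>I. y i = z i) \<longrightarrow> F y = F z)"

lemma depends_onD: "depends_on I F \<Longrightarrow> (\<And>i. i \<in> I \<Longrightarrow> y i = z i) \<Longrightarrow> F y = F z"
  by (auto simp: depends_on_def)

lemma depends_on_mono: "depends_on I F \<Longrightarrow> I \<subseteq> J \<Longrightarrow> depends_on J F"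
  by (auto simp: depends_on_def)

text \<open>The dual form of resampling: \<open>y i\<close> is read as the type of the ancestor of
  \<open>i\<close>, and the type of \<open>i\<close> itself is averaged over the row
  \<open>M (y i)\<close>.\<close>

definition act :: "'i \<Rightarrow> ('g::finite \<Rightarrow> 'g \<Rightarrow> real) \<Rightarrow> (('i \<Rightarrow> 'g) \<Rightarrow> real) \<Rightarrow> ('i \<Rightarrow> 'g) \<Rightarrow> real" where
  "act i M F y = (\<Sum>g\<in>UNIV. M (y i) g * F (y(i := g)))"

text \<open>The list only fixes an order of composition. On distinct lists this order is immaterial,
  because actions at different sites commute.\<close>

fun acts :: "'i list \<Rightarrow> ('i \<Rightarrow> 'g::finite \<Rightarrow> 'g \<Rightarrow> real) \<Rightarrow> (('i \<Rightarrow> 'g) \<Rightarrow> real) \<Rightarrow> ('i \<Rightarrow> 'g) \<Rightarrow> real" where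
  "acts [] M F = F"
| "acts (i # is) M F = act i (M i) (acts is M F)"

lemma depends_on_act:
  assumes "depends_on I F" "i \<in> I"
  shows "depends_on I (act i M F)"
  unfolding depends_on_def act_def
proof (intro allI impI)
  fix y z :: "'a \<Rightarrow> 'b" assume yz: "\<forall>i\<in>I. y i = z i"
  then have "F (y(i := g)) = F (z(i := g))" for g
    by (intro depends_onD[OF assms(1)]) auto
  then show "(\<Sum>g\<in>UNIV. M (y i) g * F (y(i := g))) = (\<Sum>g\<in>UNIV. M (z i) g * F (z(i := g)))"
    using yz assms(2) by simp
qed

lemma depends_on_acts:
  "depends_on I F \<Longrightarrow> set is \<subseteq> I \<Longrightarrow> depends_on I (acts is M F)"
  by (induction "is") (auto intro: depends_on_act)

lemma act_id: "act i (\<lambda>x y. if x = y then 1 else 0) F = F"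
  by (rule ext) (simp add: act_def if_distrib[of "\<lambda>x. x * _"] cong: if_cong)

lemma act_commute:
  assumes "i \<noteq> j"
  shows "act i M (act j N F) = act j N (act i M F)"
proof
  fix y
  have "act i M (act j N F) y = (\<Sum>g\<in>UNIV. \<Sum>h\<in>UNIV. M (y i) g * (N (y j) h * F (y(i := g, j := h))))"
    using assms by (simp add: act_def sum_distrib_left)
  also have "\<dots> = (\<Sum>h\<in>UNIV. \<Sum>g\<in>UNIV. N (y j) h * (M (y i) g * F (y(j := h, i := g))))"
    using assms by (subst sum.swap) (simp add: fun_upd_twist mult.left_commute)
  also have "\<dots> = act j N (act i M F) y"
    using assms by (simp add: act_def sum_distrib_left)
  finally show "act i M (act j N F) y = act j N (act i M F) y" .
qed

lemma act_act: "act i M (act i N F) = act i (\<lambda>x y. \<Sum>z\<in>UNIV. M x z * N z y) F"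
proof
  fix y
  have "act i M (act i N F) y = (\<Sum>g\<in>UNIV. \<Sum>h\<in>UNIV. M (y i) g * N g h * F (y(i := h)))"
    by (simp add: act_def sum_distrib_left mult.assoc)
  also have "\<dots> = act i (\<lambda>x y. \<Sum>z\<in>UNIV. M x z * N z y) F y"
    by (subst sum.swap) (simp add: act_def sum_distrib_right)
  finally show "act i M (act i N F) y = act i (\<lambda>x y. \<Sum>z\<in>UNIV. M x z * N z y) F y" .
qed

lemma act_sum: "act i (\<lambda>x y. \<Sum>k\<in>L. c k * M k x y) F y = (\<Sum>k\<in>L. c k * act i (M k) F y)"
  unfolding act_def sum_distrib_left sum_distrib_right
  by (subst sum.swap) (simp add: mult.assoc)

lemma acts_commute: "i \<notin> set is \<Longrightarrow> acts is M (act i N F) = act i N (acts is M F)"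
  by (induction "is") (auto simp: act_commute)

lemma acts_cong: "(\<And>i. i \<in> set is \<Longrightarrow> M i = N i) \<Longrightarrow> acts is M F = acts is N F"
  by (induction "is") auto

lemma acts_remove1:
  "i \<in> set is \<Longrightarrow> acts is M F = act i (M i) (acts (remove1 i is) M F)"
  by (induction "is") (auto simp: act_commute)

lemma acts_id:
  "(\<And>i. i \<in> set is \<Longrightarrow> M i = (\<lambda>x y. if x = y then 1 else 0)) \<Longrightarrow> acts is M F = F"
  by (induction "is") (auto simp: act_id)

text \<open>The row sum \<open>r\<close> is left free because the bound serves stochastic matrices
  and also the residual matrix of smaller mass that a Doeblin minorisation leaves.\<close>

lemma act_bound:
  assumes "\<And>x g. 0 \<le> M x g" "\<And>x. (\<Sum>g\<in>UNIV. M x g) = r" "\<And>y. \<bar>F y\<bar> \<le> b"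
  shows "\<bar>act i M F y\<bar> \<le> r * b"
proof -
  have "\<bar>act i M F y\<bar> \<le> (\<Sum>g\<in>UNIV. M (y i) g * b)"
    unfolding act_def
    by (intro order_trans[OF sum_abs] sum_mono) (simp add: abs_mult assms mult_left_mono)
  also have "\<dots> = r * b" by (simp add: assms(2) flip: sum_distrib_right)
  finally show ?thesis .
qed

section \<open>Sums weighted by the step law\<close>

locale imitation =
  fixes A :: "nat set" and \<theta> :: "nat \<Rightarrow> real" and P :: "nat \<Rightarrow> 'g::finite \<Rightarrow> 'g \<Rightarrow> real"
  assumes A_pos: "0 \<notin> A"
    and theta_pos: "\<forall>k\<in>A. \<theta> k > 0"
    and theta_prob: "(\<theta> has_sum 1) A"
    and stoch: "\<forall>k\<in>A. stochastic (P k)"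
begin

lemma theta_nonneg: "k \<in> A \<Longrightarrow> 0 \<le> \<theta> k"
  using theta_pos by force

lemma P_nonneg: "k \<in> A \<Longrightarrow> 0 \<le> P k i j"
  and P_row: "k \<in> A \<Longrightarrow> (\<Sum>j\<in>UNIV. P k i j) = 1"
  using stoch by (auto simp: stochastic_def)

lemma P_le_1: "k \<in> A \<Longrightarrow> P k i j \<le> 1"
  using member_le_sum[of j UNIV "P k i"] P_nonneg P_row by auto

lemma theta_tail:
  assumes "finite L" "L \<subseteq> A"
  shows "(\<theta> has_sum (1 - sum \<theta> L)) (A - L)"
  by (rule has_sum_Diff[OF theta_prob has_sum_finite]) (use assms in auto)

lemma theta_sum_le_1: "finite L \<Longrightarrow> L \<subseteq> A \<Longrightarrow> sum \<theta> L \<le> 1"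
  using has_sum_nonneg[OF theta_tail] theta_nonneg by fastforce

lemma has_sum_tail_bound:
  fixes f :: "nat \<Rightarrow> real"
  assumes f: "((\<lambda>k. \<theta> k * f k) has_sum s) A" and L: "finite L" "L \<subseteq> A"
    and b: "\<And>k. k \<in> A \<Longrightarrow> \<bar>f k\<bar> \<le> b"
  shows "\<bar>s - (\<Sum>k\<in>L. \<theta> k * f k)\<bar> \<le> b * (1 - sum \<theta> L)"
proof -
  have 1: "((\<lambda>k. \<theta> k * f k) has_sum (s - (\<Sum>k\<in>L. \<theta> k * f k))) (A - L)"
    by (rule has_sum_Diff[OF f has_sum_finite]) (use L in auto)
  have 2: "((\<lambda>k. b * \<theta> k) has_sum (b * (1 - sum \<theta> L))) (A - L)"
    by (rule has_sum_cmult_right[OF theta_tail[OF L]])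
  have "norm (s - (\<Sum>k\<in>L. \<theta> k * f k)) \<le> b * (1 - sum \<theta> L)"
    using 1 2
  proof (rule norm_infsum_le)
    show "norm (\<theta> k * f k) \<le> b * \<theta> k" if "k \<in> A - L" for k
      using that b[of k] theta_nonneg[of k] by (simp add: abs_mult mult.commute[of b] mult_left_mono)
  qed
  then show ?thesis by simp
qed

text \<open>The converse of \<open>has_sum_tail_bound\<close>: error bounds for finite truncations
  characterise the infinite sum. In this form an infinite sum can be integrated, or passed to a
  limit of laws, without dominated convergence.\<close>

lemma has_sumI_tail_bound:
  fixes f :: "nat \<Rightarrow> real"
  assumes "\<And>L. finite L \<Longrightarrow> L \<subseteq> A \<Longrightarrow> \<bar>s - (\<Sum>k\<in>L. \<theta> k * f k)\<bar> \<le> b * (1 - sum \<theta> L)"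
  shows "((\<lambda>k. \<theta> k * f k) has_sum s) A"
  unfolding has_sum_def
proof (rule tendsto_sandwich[of "\<lambda>L. s - b * (1 - sum \<theta> L)" _ _ "\<lambda>L. s + b * (1 - sum \<theta> L)"])
  have lim: "(sum \<theta> \<longlongrightarrow> 1) (finite_subsets_at_top A)"
    using theta_prob by (simp add: has_sum_def)
  have "((\<lambda>L. s - b * (1 - sum \<theta> L)) \<longlongrightarrow> s - b * (1 - 1)) (finite_subsets_at_top A)"
    by (intro tendsto_intros lim)
  then show "((\<lambda>L. s - b * (1 - sum \<theta> L)) \<longlongrightarrow> s) (finite_subsets_at_top A)" by simp
  have "((\<lambda>L. s + b * (1 - sum \<theta> L)) \<longlongrightarrow> s + b * (1 - 1)) (finite_subsets_at_top A)"
    by (intro tendsto_intros lim)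
  then show "((\<lambda>L. s + b * (1 - sum \<theta> L)) \<longlongrightarrow> s) (finite_subsets_at_top A)" by simp
  show "\<forall>\<^sub>F L in finite_subsets_at_top A. s - b * (1 - sum \<theta> L) \<le> (\<Sum>k\<in>L. \<theta> k * f k)"
    using assms by (intro eventually_finite_subsets_at_top_weakI) (fastforce simp: abs_le_iff)
  show "\<forall>\<^sub>F L in finite_subsets_at_top A. (\<Sum>k\<in>L. \<theta> k * f k) \<le> s + b * (1 - sum \<theta> L)"
    using assms by (intro eventually_finite_subsets_at_top_weakI) (fastforce simp: abs_le_iff)
qed

subsection \<open>Ancestral renewal matrices\<close>

definition letters :: "nat \<Rightarrow> nat set" where
  "letters d = {k \<in> A. k \<le> d}"

lemma letters: "finite (letters d)" "letters d \<subseteq> A" "k \<in> letters d \<Longrightarrow> 0 < k \<and> k \<le> d \<and> k \<in> A"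
  using A_pos by (auto simp: letters_def intro: gr0I)

text \<open>\<open>hit d i j\<close> is the weight of all ancestral paths that visit the site exactly \<open>d\<close> steps back,
  with type \<open>i\<close> there and type \<open>j\<close> at the start.\<close>

function hit :: "nat \<Rightarrow> 'g \<Rightarrow> 'g \<Rightarrow> real" where
  "hit d i j = (if d = 0 then (if i = j then 1 else 0)
     else (\<Sum>k\<in>letters d. \<theta> k * (\<Sum>x\<in>UNIV. hit (d - k) i x * P k x j)))"
  by auto
termination
proof (relation "Wellfounded.measure fst")
qed (auto dest!: letters(3))

text \<open>The renewal sequence of the step law \<theta>: the probability that an ancestral line
  visits the site \<open>d\<close> steps back. It is the common row sum of \<open>hit d\<close>, and
  \<open>1 - renewal d\<close> is the mass of the lines that jump over that site.\<close>

function renewal :: "nat \<Rightarrow> real" where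
  "renewal d = (if d = 0 then 1 else (\<Sum>k\<in>letters d. \<theta> k * renewal (d - k)))"
  by auto
termination
proof (relation "Wellfounded.measure id")
qed (auto dest!: letters(3))

declare hit.simps [simp del] renewal.simps [simp del]

lemma hit_0 [simp]: "hit 0 = (\<lambda>i j. if i = j then 1 else 0)"
  by (intro ext) (simp add: hit.simps)

lemma renewal_0 [simp]: "renewal 0 = 1"
  by (simp add: renewal.simps)

lemma hit_nonneg: "0 \<le> hit d i j"
proof (induction d arbitrary: j rule: less_induct)
  case (less d)
  show ?case
  proof (cases "d = 0")
    case False
    then have "0 \<le> hit (d - k) i x" if "k \<in> letters d" for k x
      using less[of "d - k"] letters(3)[OF that] by simp
    then show ?thesis using letters(3) theta_nonneg P_nonneg
      by (subst hit.simps) (auto intro!: sum_nonneg mult_nonneg_nonneg)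
  qed auto
qed

lemma hit_row: "(\<Sum>j\<in>UNIV. hit d i j) = renewal d"
proof (induction d rule: less_induct)
  case (less d)
  show ?case
  proof (cases "d = 0")
    case False
    have "(\<Sum>j\<in>UNIV. hit d i j) = (\<Sum>j\<in>UNIV. \<Sum>k\<in>letters d. \<theta> k * (\<Sum>x\<in>UNIV. hit (d - k) i x * P k x j))"
      using False by (subst hit.simps) simp
    also have "\<dots> = (\<Sum>k\<in>letters d. \<theta> k * (\<Sum>j\<in>UNIV. \<Sum>x\<in>UNIV. hit (d - k) i x * P k x j))"
      by (subst sum.swap) (simp add: sum_distrib_left)
    also have "\<dots> = (\<Sum>k\<in>letters d. \<theta> k * (\<Sum>x\<in>UNIV. hit (d - k) i x * (\<Sum>j\<in>UNIV. P k x j)))"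
      by (subst sum.swap) (simp add: sum_distrib_left)
    also have "\<dots> = (\<Sum>k\<in>letters d. \<theta> k * renewal (d - k))"
    proof (rule sum.cong[OF refl])
      fix k assume "k \<in> letters d"
      then show "\<theta> k * (\<Sum>x\<in>UNIV. hit (d - k) i x * (\<Sum>j\<in>UNIV. P k x j)) = \<theta> k * renewal (d - k)"
        using letters(3)[of k d] less[of "d - k"] by (simp add: P_row)
    qed
    also have "\<dots> = renewal d" using False by (subst (2) renewal.simps) simp
    finally show ?thesis .
  qed simp
qed

lemma renewal_nonneg: "0 \<le> renewal d"
  unfolding hit_row[of d undefined, symmetric] by (intro sum_nonneg hit_nonneg)

lemma renewal_le_1: "renewal d \<le> 1"
proof (induction d rule: less_induct)
  case (less d)
  show ?case
  proof (cases "d = 0")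
    case False
    then have "renewal d = (\<Sum>k\<in>letters d. \<theta> k * renewal (d - k))"
      by (subst renewal.simps) simp
    also have "\<dots> \<le> (\<Sum>k\<in>letters d. \<theta> k * 1)"
      using False less letters(3) theta_nonneg by (intro sum_mono mult_left_mono) auto
    also have "\<dots> \<le> 1" using theta_sum_le_1[OF letters(1,2)] by simp
    finally show ?thesis .
  qed simp
qed

text \<open>The head of the word is the most recent jump, which is the letter that the recursion of
  \<open>hit\<close> sums over; induction on the word therefore isolates one positive
  summand.\<close>

lemma hit_pos:
  "set a \<subseteq> A \<Longrightarrow> word_mat P a i j > 0 \<Longrightarrow> hit (sum_list a) i j > 0"
proof (induction a arbitrary: j)
  case Nil
  then show ?case by (simp split: if_splits)
next
  case (Cons k a)
  have k: "k \<in> A" "k > 0" using Cons.prems A_pos by (auto intro: gr0I)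
  have "\<exists>x. word_mat P a i x * P k x j > 0"
  proof (rule ccontr)
    assume "\<not> ?thesis"
    then have "word_mat P (k # a) i j \<le> 0" by (auto intro!: sum_nonpos simp: not_less)
    then show False using Cons.prems by simp
  qed
  then obtain x where x: "word_mat P a i x * P k x j > 0" by blast
  then have "word_mat P a i x > 0" "P k x j > 0"
    using P_nonneg[OF k(1), of x j] word_mat_nonneg[OF stoch, of a i x] Cons.prems(1)
    by (auto simp: zero_less_mult_iff)
  then have pos: "hit (sum_list a) i x * P k x j > 0" using Cons by (intro mult_pos_pos) auto
  have "0 < (\<Sum>x\<in>UNIV. hit (sum_list a) i x * P k x j)"
    using k pos by (intro sum_pos2[where i = x]) (auto intro!: mult_nonneg_nonneg hit_nonneg P_nonneg)
  then have "0 < \<theta> k * (\<Sum>x\<in>UNIV. hit (sum_list a) i x * P k x j)"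
    using theta_pos k by simp
  then have k_pos: "0 < \<theta> k * (\<Sum>x\<in>UNIV. hit (sum_list (k # a) - k) i x * P k x j)" by simp
  have "sum_list (k # a) \<noteq> 0" "k \<in> letters (sum_list (k # a))"
    using k by (auto simp: letters_def)
  then have "0 < (\<Sum>l\<in>letters (sum_list (k # a)).
      \<theta> l * (\<Sum>x\<in>UNIV. hit (sum_list (k # a) - l) i x * P l x j))"
    using k_pos letters(3) theta_nonneg
    by (intro sum_pos2[where i = k] letters(1) mult_nonneg_nonneg sum_nonneg hit_nonneg P_nonneg) blast+
  then show ?case using \<open>sum_list (k # a) \<noteq> 0\<close> by (subst hit.simps) (simp only: if_False)
qed

lemma hit_eventually_pos:
  assumes "aperiodic_sf A P"
  shows "\<exists>s>0. \<forall>d\<ge>s. \<forall>i j. hit d i j > 0"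
proof -
  obtain s where s: "\<forall>d\<ge>s. \<forall>i j. \<exists>a. set a \<subseteq> A \<and> sum_list a = d \<and> word_mat P a i j > 0"
    using aperiodic_all_depths[OF stoch assms] by blast
  \<comment> \<open>The successor makes the threshold positive; it later becomes the length of a
    window and a divisor.\<close>
  have "hit d i j > 0" if "d \<ge> Suc s" for d i j
    using s hit_pos that by (metis Suc_leD)
  then show ?thesis by blast
qed

text \<open>A minimum over finitely many entries. Only a bounded range of depths is covered, since
  \<open>renewal d\<close>, and with it every entry of \<open>hit d\<close>, may tend to 0 when
  \<theta> has infinite mean.\<close>

lemma hit_uniformly_pos:
  assumes "\<And>d i j. d \<ge> s \<Longrightarrow> hit d i j > 0"
  shows "\<exists>\<delta>>0. \<delta> \<le> 1 \<and> (\<forall>d\<in>{s..B}. \<forall>i j. \<delta> \<le> hit d i j)"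
proof -
  \<comment> \<open>The element 1 gives \<delta> \<le> 1 and keeps the set nonempty when the range
    of depths is empty.\<close>
  define S where "S = insert 1 ((\<lambda>(d, i, j). hit d i j) ` ({s..B} \<times> UNIV \<times> UNIV))"
  have "finite S" "S \<noteq> {}" by (auto simp: S_def)
  moreover from this have "Min S > 0" using assms by (subst Min_gr_iff) (auto simp: S_def)
  moreover have "hit d i j \<in> S" if "d \<in> {s..B}" for d i j
    unfolding S_def using that by (intro insertI2 image_eqI[of _ _ "(d, i, j)"]) auto
  moreover have "1 \<in> S" by (simp add: S_def)
  ultimately show ?thesis by (intro exI[of _ "Min S"]) (metis Min_le)
qed

end

text \<open>An abstract difference of two solutions: \<open>D p F\<close> is the difference of the expectations of
  \<open>F\<close> evaluated at the types of the sites \<open>p\<close>.\<close>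

locale signed_duality = imitation A \<theta> P
  for A \<theta> and P :: "nat \<Rightarrow> 'g::finite \<Rightarrow> 'g \<Rightarrow> real" +
  fixes I :: "'i set" and D :: "('i \<Rightarrow> int) \<Rightarrow> (('i \<Rightarrow> 'g) \<Rightarrow> real) \<Rightarrow> real" and C :: real
  assumes finite_I: "finite I"
    and D_add: "\<And>p F G. depends_on I F \<Longrightarrow> depends_on I G \<Longrightarrow> D p (\<lambda>y. F y + G y) = D p F + D p G"
    and D_scale: "\<And>p F c. depends_on I F \<Longrightarrow> D p (\<lambda>y. c * F y) = c * D p F"
    and D_bounded: "\<And>p F. depends_on I F \<Longrightarrow> (\<And>y. \<bar>F y\<bar> \<le> 1) \<Longrightarrow> \<bar>D p F\<bar> \<le> C"
    and D_top: "\<And>p F i. depends_on I F \<Longrightarrow> i \<in> I \<Longrightarrow> (\<And>j. j \<in> I - {i} \<Longrightarrow> p j < p i) \<Longrightarrow>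
      ((\<lambda>k. \<theta> k * D (p(i := p i - int k)) (act i (P k) F)) has_sum D p F) A"
    and D_not_inj: "\<And>p F. depends_on I F \<Longrightarrow> \<not> inj_on p I \<Longrightarrow> D p F = 0"
    and D_marginal: "\<And>p F i. i \<in> I \<Longrightarrow> depends_on (I - {i}) F \<Longrightarrow> D p F = 0"
begin

section \<open>Strict contraction of the difference functional\<close>

definition D_norm :: real where
  "D_norm = Sup {\<bar>D p F\<bar> | p F. depends_on I F \<and> (\<forall>y. \<bar>F y\<bar> \<le> 1)}"

lemma D_zero: "D p (\<lambda>y. 0) = 0"
  using D_scale[of "\<lambda>y. 0" p 0] by (simp add: depends_on_def)

lemma D_norm_upper:
  assumes "depends_on I F" "\<And>y. \<bar>F y\<bar> \<le> 1"
  shows "\<bar>D p F\<bar> \<le> D_norm"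
  unfolding D_norm_def
proof (rule cSup_upper)
  show "\<bar>D p F\<bar> \<in> {\<bar>D p F\<bar> | p F. depends_on I F \<and> (\<forall>y. \<bar>F y\<bar> \<le> 1)}"
    using assms by blast
  show "bdd_above {\<bar>D p F\<bar> | p F. depends_on I F \<and> (\<forall>y. \<bar>F y\<bar> \<le> 1)}"
    unfolding bdd_above_def using D_bounded by blast
qed

lemma D_norm_least:
  assumes "\<And>p F. depends_on I F \<Longrightarrow> (\<And>y. \<bar>F y\<bar> \<le> 1) \<Longrightarrow> \<bar>D p F\<bar> \<le> c"
  shows "D_norm \<le> c"
  unfolding D_norm_def
proof (rule cSup_least)
  have "depends_on I (\<lambda>y :: 'i \<Rightarrow> 'g. 0 :: real)" by (simp add: depends_on_def)
  moreover have "\<forall>y :: 'i \<Rightarrow> 'g. \<bar>0 :: real\<bar> \<le> 1" by simp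
  ultimately show "{\<bar>D p F\<bar> | p F. depends_on I F \<and> (\<forall>y. \<bar>F y\<bar> \<le> 1)} \<noteq> {}" by blast
qed (use assms in blast)

lemma D_norm_nonneg: "0 \<le> D_norm"
proof -
  have "\<bar>D undefined (\<lambda>y. 0)\<bar> \<le> D_norm" by (rule D_norm_upper) (simp_all add: depends_on_def)
  then show ?thesis by linarith
qed

lemma D_le_D_norm:
  assumes "depends_on I F" "\<And>y. \<bar>F y\<bar> \<le> b"
  shows "\<bar>D p F\<bar> \<le> D_norm * b"
proof (cases "b = 0")
  case True
  then have "F = (\<lambda>y. 0)" using assms(2) by (intro ext) auto
  then show ?thesis using True by (simp add: D_zero)
next
  case False
  moreover have "0 \<le> b" using assms(2)[of undefined] by linarith
  ultimately have b: "b > 0" by simp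
  have dep: "depends_on I (\<lambda>y. (1/b) * F y)"
    using assms(1) by (auto simp: depends_on_def)
  have "\<bar>D p (\<lambda>y. (1/b) * F y)\<bar> \<le> D_norm"
    using b assms(2) by (intro D_norm_upper dep) (simp add: abs_mult)
  then have "\<bar>(1/b) * D p F\<bar> \<le> D_norm" by (simp only: D_scale[OF assms(1)])
  then show ?thesis using b by (simp add: abs_mult field_simps)
qed

lemma D_sum:
  assumes "finite L" "\<And>k. k \<in> L \<Longrightarrow> depends_on I (F k)"
  shows "D p (\<lambda>y. \<Sum>k\<in>L. c k * F k y) = (\<Sum>k\<in>L. c k * D p (F k))"
  using assms
proof (induction L)
  case empty
  then show ?case by (simp add: D_zero)
next
  case (insert k L)
  have "depends_on I (\<lambda>y. c k * F k y)"
    using insert.prems[of k] by (auto simp: depends_on_def)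
  moreover have "depends_on I (\<lambda>y. \<Sum>k\<in>L. c k * F k y)"
    unfolding depends_on_def
  proof (intro allI impI sum.cong refl)
    fix y z :: "'i \<Rightarrow> 'g" and j assume "\<forall>i\<in>I. y i = z i" "j \<in> L"
    then show "c j * F j y = c j * F j z"
      using insert.prems[of j] depends_onD[of I "F j" y z] by simp
  qed
  ultimately show ?case using insert by (simp add: D_add D_scale)
qed

lemma ex_top:
  fixes p :: "'i \<Rightarrow> int"
  assumes "I \<noteq> {}"
  shows "\<exists>i\<in>I. \<forall>j\<in>I. p j \<le> p i"
proof -
  have "Max (p ` I) \<in> p ` I" using finite_I assms by (intro Max_in) auto
  then obtain i where "i \<in> I" "Max (p ` I) = p i" by blast
  then show ?thesis using finite_I by (metis Max_ge finite_imageI imageI)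
qed

text \<open>Positions outside \<open>I\<close> are left alone so that \<open>capped t p = p\<close>
  holds as an equation of functions once no site of \<open>I\<close> is above \<open>t\<close>; this
  closes the recursion in \<open>absorb_at_level\<close>.\<close>

definition capped :: "int \<Rightarrow> ('i \<Rightarrow> int) \<Rightarrow> 'i \<Rightarrow> int" where
  "capped t p i = (if i \<in> I then min (p i) t else p i)"

text \<open>All sites above \<open>t\<close> are replaced by their ancestors, keeping only the ancestral lines that
  visit \<open>t\<close>; the lost mass is what the bound accounts for.\<close>

lemma absorb_at_level:
  assumes xs: "set xs = I" "distinct xs"
    and F: "depends_on I F" "\<And>y. \<bar>F y\<bar> \<le> b"
  shows "\<bar>D p F - D (capped t p) (acts xs (\<lambda>i. hit (nat (p i - t))) F)\<bar>
    \<le> D_norm * b * (1 - (\<Prod>i\<in>I. renewal (nat (p i - t))))"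
  using F
proof (induction "\<Sum>i\<in>I. nat (p i - t)" arbitrary: p F rule: less_induct)
  case less
  have b: "0 \<le> b" using less.prems(2)[of undefined] by linarith
  have prod_le: "(\<Prod>i\<in>J. renewal (nat (p i - t))) \<le> 1" for J
    by (intro prod_le_1) (auto simp: renewal_nonneg renewal_le_1)
  \<comment> \<open>Capping preserves coincidences, so without injectivity both values of
    \<open>D\<close> vanish. With injectivity the top site is strictly above the others, as
    \<open>D_top\<close> demands.\<close>
  consider "\<not> inj_on p I" | "\<forall>i\<in>I. p i \<le> t" | "inj_on p I" "\<exists>i\<in>I. t < p i"
    by fastforce
  then show ?case
  proof cases
    case 1
    then have "\<not> inj_on (capped t p) I" unfolding inj_on_def capped_def by metis
    then have "D (capped t p) (acts xs (\<lambda>i. hit (nat (p i - t))) F) = 0"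
      using less.prems xs by (intro D_not_inj depends_on_acts) auto
    moreover have "D p F = 0" using 1 less.prems by (intro D_not_inj)
    ultimately show ?thesis using prod_le b D_norm_nonneg by simp
  next
    case 2
    then have "capped t p = p" by (auto simp: capped_def)
    moreover have "acts xs (\<lambda>i. hit (nat (p i - t))) F = F"
      using 2 xs by (intro acts_id) auto
    ultimately show ?thesis using prod_le b D_norm_nonneg by simp
  next
    case 3
    obtain i where i: "i \<in> I" "\<forall>j\<in>I. p j \<le> p i" using ex_top 3(2) by blast
    then have top: "p j < p i" if "j \<in> I - {i}" for j
      using that 3(1) by (metis DiffD1 DiffD2 inj_onD insertCI order_le_less)
    have t: "t < p i" using i 3(2) by force
    define d where "d = nat (p i - t)"
    have d: "d > 0" "int d = p i - t" using t by (auto simp: d_def)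
    define M where "M = (\<lambda>i. hit (nat (p i - t)))"
    \<comment> \<open>The factor of the sites other than \<open>i\<close>, unchanged by a jump of
      the line of \<open>i\<close>.\<close>
    define R where "R = (\<Prod>j\<in>I - {i}. renewal (nat (p j - t)))"
    define pk where "pk k = p(i := p i - int k)" for k
    define Fk where "Fk k = act i (P k) F" for k
    define G where "G = acts (remove1 i xs) M F"
    have i_xs: "i \<in> set xs" "i \<notin> set (remove1 i xs)" using i xs by auto
    have F_dep: "depends_on I F" by fact
    have Fk_dep: "depends_on I (Fk k)" for k
      using less.prems(1) i(1) by (auto simp: Fk_def intro: depends_on_act)
    have Fk_bd: "\<bar>Fk k y\<bar> \<le> b" if "k \<in> A" for k y
      using act_bound[of "P k" 1 F b i y] that less.prems(2) P_nonneg P_row by (simp add: Fk_def)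
    have R: "0 \<le> R" by (auto simp: R_def intro!: prod_nonneg renewal_nonneg)
    have prod_eq: "(\<Prod>j\<in>I. renewal (nat (p j - t))) = renewal d * R"
      using finite_I i(1) by (simp add: R_def d_def prod.remove)
    have IH: "\<bar>D (pk k) (Fk k) - D (capped t p) (act i (hit (d - k)) (act i (P k) G))\<bar>
        \<le> D_norm * b * (1 - renewal (d - k) * R)" if k: "k \<in> letters d" for k
    proof -
      have k': "0 < k" "k \<le> d" "k \<in> A" using letters(3)[OF k] by auto
      have pk_i: "nat (pk k i - t) = d - k" using d(2) k'(2) by (simp add: pk_def d_def)
      have less_sum: "(\<Sum>j\<in>I. nat (pk k j - t)) < (\<Sum>j\<in>I. nat (p j - t))"
      proof (rule sum_strict_mono_ex1[OF finite_I])
        show "\<forall>j\<in>I. nat (pk k j - t) \<le> nat (p j - t)" by (auto simp: pk_def)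
        show "\<exists>j\<in>I. nat (pk k j - t) < nat (p j - t)"
          using i(1) k' d pk_i by (intro bexI[of _ i]) (auto simp flip: d_def)
      qed
      have "capped t (pk k) = capped t p"
        using k' d i(1) by (auto simp: capped_def pk_def fun_eq_iff)
      moreover have "acts xs (\<lambda>j. hit (nat (pk k j - t))) (Fk k) = act i (hit (d - k)) (act i (P k) G)"
      proof -
        have "acts xs (\<lambda>j. hit (nat (pk k j - t))) (Fk k)
            = act i (hit (d - k)) (acts (remove1 i xs) (\<lambda>j. hit (nat (pk k j - t))) (Fk k))"
          by (subst acts_remove1[OF i_xs(1)]) (simp only: pk_i)
        also have "acts (remove1 i xs) (\<lambda>j. hit (nat (pk k j - t))) (Fk k) = acts (remove1 i xs) M (Fk k)"
          using i_xs(2) by (intro acts_cong) (auto simp: M_def pk_def)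
        also have "\<dots> = act i (P k) G"
          unfolding Fk_def G_def by (rule acts_commute[OF i_xs(2)])
        finally show ?thesis .
      qed
      moreover have "(\<Prod>j\<in>I. renewal (nat (pk k j - t))) = renewal (d - k) * R"
        using finite_I i(1) pk_i by (simp add: R_def prod.remove[of I i] pk_def)
      ultimately show ?thesis
        using less.hyps[OF less_sum Fk_dep Fk_bd[OF k'(3)]] by simp
    qed
    have dep_k: "depends_on I (act i (hit (d - k)) (act i (P k) G))" for k
      unfolding G_def using i(1) xs F_dep
      by (intro depends_on_act depends_on_acts) (auto dest: notin_set_remove1)
    have "acts xs M F = act i (hit d) G"
      unfolding G_def using acts_remove1[OF i_xs(1), of M F] by (simp add: M_def d_def)
    also have "hit d = (\<lambda>x y. \<Sum>k\<in>letters d. \<theta> k * (\<Sum>z\<in>UNIV. hit (d - k) x z * P k z y))"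
      using d by (intro ext) (subst hit.simps, simp)
    also have "act i \<dots> G = (\<lambda>y. \<Sum>k\<in>letters d. \<theta> k * act i (hit (d - k)) (act i (P k) G) y)"
      by (rule ext) (simp add: act_sum act_act)
    finally have "D (capped t p) (acts xs M F)
        = (\<Sum>k\<in>letters d. \<theta> k * D (capped t p) (act i (hit (d - k)) (act i (P k) G)))"
      by (simp add: D_sum[OF letters(1) dep_k])
    \<comment> \<open>Letters above \<open>d\<close> jump over \<open>t\<close>: their contribution
      is bounded by \<open>D_norm * b\<close> times their total weight. Letters up to
      \<open>d\<close> leave the line of \<open>i\<close> at or above \<open>t\<close>, where the
      induction hypothesis applies.\<close>
    then have split: "D p F - D (capped t p) (acts xs M F)
        = (D p F - (\<Sum>k\<in>letters d. \<theta> k * D (pk k) (Fk k)))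
          + (\<Sum>k\<in>letters d. \<theta> k * (D (pk k) (Fk k) - D (capped t p) (act i (hit (d - k)) (act i (P k) G))))"
      by (simp add: sum_subtractf right_diff_distrib)
    have "\<bar>D p F - D (capped t p) (acts xs M F)\<bar> \<le> D_norm * b * (1 - sum \<theta> (letters d))
        + (\<Sum>k\<in>letters d. \<theta> k * (D_norm * b * (1 - renewal (d - k) * R)))"
      unfolding split
    proof (rule order_trans[OF abs_triangle_ineq add_mono])
      show "\<bar>D p F - (\<Sum>k\<in>letters d. \<theta> k * D (pk k) (Fk k))\<bar> \<le> D_norm * b * (1 - sum \<theta> (letters d))"
        using D_top[where p = p and i = i, OF F_dep i(1) top]
        by (intro has_sum_tail_bound letters(1,2))
           (auto simp: pk_def Fk_def[symmetric] intro!: D_le_D_norm Fk_dep Fk_bd)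
      show "\<bar>\<Sum>k\<in>letters d. \<theta> k * (D (pk k) (Fk k) - D (capped t p) (act i (hit (d - k)) (act i (P k) G)))\<bar>
          \<le> (\<Sum>k\<in>letters d. \<theta> k * (D_norm * b * (1 - renewal (d - k) * R)))"
      proof (rule order_trans[OF sum_abs sum_mono])
        fix k assume k: "k \<in> letters d"
        then have "0 \<le> \<theta> k" using letters(3) theta_nonneg by blast
        then show "\<bar>\<theta> k * (D (pk k) (Fk k) - D (capped t p) (act i (hit (d - k)) (act i (P k) G)))\<bar>
          \<le> \<theta> k * (D_norm * b * (1 - renewal (d - k) * R))"
          using IH[OF k] by (simp add: abs_mult mult_left_mono)
      qed
    qed
    \<comment> \<open>The weight of \<open>letters d\<close> cancels, and the renewal equation for
      \<open>renewal d\<close> collects the remaining terms.\<close>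
    also have "\<dots> = D_norm * b * (1 - renewal d * R)"
    proof -
      have "x * (c * (1 - r * R)) = c * (x - x * r * R)" for x c r :: real
        by (simp add: algebra_simps)
      then have "(\<Sum>k\<in>letters d. \<theta> k * (D_norm * b * (1 - renewal (d - k) * R)))
          = D_norm * b * (sum \<theta> (letters d) - (\<Sum>k\<in>letters d. \<theta> k * renewal (d - k)) * R)"
        by (simp only: sum_subtractf sum_distrib_left[symmetric] sum_distrib_right[symmetric])
      moreover have "(\<Sum>k\<in>letters d. \<theta> k * renewal (d - k)) = renewal d"
        using d by (subst (2) renewal.simps) simp
      ultimately show ?thesis by (simp add: right_diff_distrib)
    qed
    finally show ?thesis by (simp add: prod_eq M_def)
  qed
qed

text \<open>Everything happens within depth \<open>(card I + 1) * s\<close> below the top site,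
  whatever \<open>p\<close> is, so a single \<delta> serves all configurations. The power of
  \<delta> accounts for up to \<open>card I\<close> lines that must all land on the same
  level.\<close>

lemma D_norm_contracts:
  assumes s: "s > 0" and \<delta>: "0 < \<delta>" "\<delta> \<le> 1"
    and hit: "\<And>d i j. d \<in> {s..(card I + 1) * s} \<Longrightarrow> \<delta> \<le> hit d i j"
    and ne: "I \<noteq> {}"
    and F: "depends_on I F" "\<And>y. \<bar>F y\<bar> \<le> 1"
  shows "\<bar>D p F\<bar> \<le> D_norm * (1 - \<delta> ^ card I)"
proof -
  obtain i where i: "i \<in> I" "\<forall>j\<in>I. p j \<le> p i" using ex_top[OF ne] by blast
  text \<open>By pigeonhole some window of length \<open>s\<close> below the top site contains no site of \<open>p\<close>.\<close>
  define f where "f j = nat ((p i - p j) div int s)" for j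
  \<comment> \<open>At most \<open>card I\<close> windows are occupied, out of
    \<open>card I + 1\<close> candidates.\<close>
  have "card (f ` I) < card {0..card I}"
    using card_image_le[OF finite_I, of f] by simp
  then obtain m where m: "m \<le> card I" "m \<notin> f ` I"
    by (metis atLeastAtMost_iff card_mono finite_I finite_imageI le_antisym less_le not_le subsetI)
  \<comment> \<open>The level just below the free window: sites in earlier windows are at least
    \<open>s\<close> above \<open>t\<close>, and all remaining sites are at or below
    \<open>t\<close>.\<close>
  define t where "t = p i - int (m + 1) * int s"
  have window: "nat (p j - t) \<in> {s..(card I + 1) * s}" if j: "j \<in> I" "t < p j" for j
  proof -
    define q where "q = (p i - p j) div int s"
    have q: "q * int s \<le> p i - p j" "p i - p j < (q + 1) * int s"
      using s pos_mod_bound[of "int s" "p i - p j"] pos_mod_sign[of "int s" "p i - p j"]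
        div_mult_mod_eq[of "p i - p j" "int s"] unfolding q_def distrib_right by linarith+
    have "q * int s < int (m + 1) * int s" using q(1) j(2) by (simp add: t_def)
    then have "q < int m + 1" using s by simp
    moreover have "0 \<le> q"
      using i(2) j(1) s by (simp add: q_def pos_imp_zdiv_nonneg_iff)
    moreover have "f j \<noteq> m" using m(2) j(1) by blast
    ultimately have "q + 1 \<le> int m" by (auto simp: f_def q_def)
    then have "(q + 1) * int s \<le> int m * int s" using s by (intro mult_right_mono) auto
    then have "p i - p j < int m * int s" using q(2) by linarith
    moreover have "p j - t \<le> int ((card I + 1) * s)"
    proof -
      have "p j - t \<le> int (m + 1) * int s" using i(2) j(1) by (simp add: t_def)
      also have "\<dots> = int ((m + 1) * s)" by (rule of_nat_mult[symmetric])
      also have "\<dots> \<le> int ((card I + 1) * s)"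
        using m(1) by (intro iffD2[OF of_nat_le_iff] mult_right_mono) auto
      finally show ?thesis .
    qed
    moreover have "int s \<le> p j - t"
      using \<open>p i - p j < int m * int s\<close> by (simp add: t_def distrib_right)
    ultimately show ?thesis unfolding atLeastAtMost_iff nat_le_iff by (simp add: le_nat_iff)
  qed
  obtain xs where xs: "set xs = I" "distinct xs" using finite_distinct_list[OF finite_I] by blast
  define M where "M = (\<lambda>i. hit (nat (p i - t)))"
  define d where "d = nat (p i - t)"
  have "t < p i" using s by (simp add: t_def)
  have d: "\<delta> \<le> hit d x y" for x y using hit window[OF i(1) \<open>t < p i\<close>] by (simp add: d_def)
  have main: "\<bar>D p F - D (capped t p) (acts xs M F)\<bar>
      \<le> D_norm * (1 - (\<Prod>j\<in>I. renewal (nat (p j - t))))"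
    using absorb_at_level[OF xs F, of p t] by (simp add: M_def)
  show ?thesis
  proof (cases "inj_on (capped t p) I")
    case False
    \<comment> \<open>Two lines meet at \<open>t\<close>, so the absorbed term vanishes and only the
      mass of configurations with some line jumping over \<open>t\<close> remains. It is small
      because one entry of \<open>hit\<close> already bounds its row sum from below.\<close>
    have "\<delta> \<le> renewal (nat (p j - t))" if "j \<in> I" for j
    proof (cases "t < p j")
      case True
      have "\<delta> \<le> hit (nat (p j - t)) undefined undefined" using hit window[OF that True] by blast
      also have "\<dots> \<le> (\<Sum>g\<in>UNIV. hit (nat (p j - t)) undefined g)"
        by (intro member_le_sum hit_nonneg) auto
      finally show ?thesis by (simp add: hit_row)
    qed (use \<delta> in simp)
    then have "(\<Prod>j\<in>I. \<delta>) \<le> (\<Prod>j\<in>I. renewal (nat (p j - t)))"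
      using \<delta> by (intro prod_mono) auto
    moreover have "D (capped t p) (acts xs M F) = 0"
      using F xs False by (intro D_not_inj depends_on_acts) auto
    moreover from calculation(1)
    have "D_norm * (1 - (\<Prod>j\<in>I. renewal (nat (p j - t)))) \<le> D_norm * (1 - \<delta> ^ card I)"
      by (intro mult_left_mono D_norm_nonneg) simp
    ultimately show ?thesis using main by simp
  next
    case True
    \<comment> \<open>A second site above \<open>t\<close> would be capped onto \<open>t\<close>
      together with \<open>i\<close>, against injectivity. Hence the line of \<open>i\<close> is the
      only one that moves.\<close>
    have below: "nat (p j - t) = 0" if "j \<in> I" "j \<noteq> i" for j
    proof (rule ccontr)
      assume "nat (p j - t) \<noteq> 0"
      then have "capped t p j = capped t p i" using that i(1) \<open>t < p i\<close> by (auto simp: capped_def)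
      then show False using True that i(1) by (auto dest: inj_onD)
    qed
    have "acts (remove1 i xs) M F = F"
      using xs below by (intro acts_id) (auto simp: M_def)
    then have acts_eq: "acts xs M F = act i (hit d) F"
      using acts_remove1[of i xs M F] i xs by (simp add: M_def d_def)
    have "(\<Prod>j\<in>I. renewal (nat (p j - t))) = renewal d * (\<Prod>j\<in>I - {i}. renewal (nat (p j - t)))"
      using finite_I i(1) by (simp add: d_def prod.remove)
    also have "(\<Prod>j\<in>I - {i}. renewal (nat (p j - t))) = 1"
      using below by (intro prod.neutral) auto
    finally have prod_eq: "(\<Prod>j\<in>I. renewal (nat (p j - t))) = renewal d" by simp
    \<comment> \<open>Doeblin splitting: the constant matrix \<delta> produces a function that
      ignores the type of \<open>i\<close>, which \<open>D\<close> annihilates, and the residual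
      matrix is still nonnegative.\<close>
    have "act i (hit d) F = (\<lambda>y. act i (\<lambda>x g. hit d x g - \<delta>) F y + act i (\<lambda>x g. \<delta>) F y)"
      by (rule ext) (simp add: act_def left_diff_distrib sum_subtractf)
    moreover have dep1: "depends_on (I - {i}) (act i (\<lambda>x g. \<delta>) F)"
      unfolding depends_on_def act_def
      using F(1) by (auto intro!: sum.cong depends_onD[OF F(1)])
    moreover have "depends_on I (act i (\<lambda>x g. \<delta>) F)"
      using dep1 by (rule depends_on_mono) auto
    moreover have dep2: "depends_on I (act i (\<lambda>x g. hit d x g - \<delta>) F)"
      using F(1) i(1) by (rule depends_on_act)
    ultimately have "D (capped t p) (act i (hit d) F) = D (capped t p) (act i (\<lambda>x g. hit d x g - \<delta>) F)"
      using D_marginal[OF i(1) dep1] by (simp add: D_add)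
    also have "\<bar>\<dots>\<bar> \<le> D_norm * ((renewal d - real CARD('g) * \<delta>) * 1)"
      using d F(2) by (intro D_le_D_norm dep2 act_bound) (auto simp: sum_subtractf hit_row)
    \<comment> \<open>Each row loses \<delta> once per type; a single \<delta> suffices. Adding the
      overshoot \<open>1 - renewal d\<close> makes \<open>renewal d\<close> cancel.\<close>
    also have "\<dots> \<le> D_norm * (renewal d - \<delta>)"
    proof (rule mult_left_mono[OF _ D_norm_nonneg])
      have "1 * \<delta> \<le> real CARD('g) * \<delta>"
        using \<delta>(1) by (intro mult_right_mono) (auto simp: Suc_le_eq)
      then show "(renewal d - real CARD('g) * \<delta>) * 1 \<le> renewal d - \<delta>" by simp
    qed
    finally have "\<bar>D p F\<bar> \<le> D_norm * (1 - renewal d) + D_norm * (renewal d - \<delta>)"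
      using main unfolding prod_eq acts_eq by linarith
    also have "\<dots> = D_norm * (1 - \<delta>)" by (simp add: algebra_simps)
    also have "\<dots> \<le> D_norm * (1 - \<delta> ^ card I)"
    proof (intro mult_left_mono diff_left_mono D_norm_nonneg)
      have "card I \<ge> 1" using ne finite_I by (simp add: Suc_le_eq card_gt_0_iff)
      then show "\<delta> ^ card I \<le> \<delta>" using power_decreasing[of 1 "card I" \<delta>] \<delta> by simp
    qed
    finally show ?thesis .
  qed
qed

theorem D_vanishes:
  assumes "aperiodic_sf A P" and ne: "I \<noteq> {}"
    and F: "depends_on I F" "\<And>y. \<bar>F y\<bar> \<le> b"
  shows "D p F = 0"
proof -
  obtain s where s: "s > 0" "\<And>d i j. d \<ge> s \<Longrightarrow> hit d i j > 0"
    using hit_eventually_pos[OF assms(1)] by blast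
  obtain \<delta> where \<delta>: "0 < \<delta>" "\<delta> \<le> 1" "\<And>d i j. d \<in> {s..(card I + 1) * s} \<Longrightarrow> \<delta> \<le> hit d i j"
    using hit_uniformly_pos[of s "(card I + 1) * s"] s(2) by blast
  \<comment> \<open>The contraction factor does not depend on the positions or on the function, so
    it passes to the supremum.\<close>
  have "D_norm \<le> D_norm * (1 - \<delta> ^ card I)"
    by (rule D_norm_least) (rule D_norm_contracts[OF s(1) \<delta> ne])
  then have "D_norm * \<delta> ^ card I \<le> 0" by (simp add: algebra_simps)
  then have "D_norm = 0"
    using D_norm_nonneg \<delta>(1) by (simp add: mult_le_0_iff power_le_zero_eq)
  then show ?thesis using D_le_D_norm[OF F, of p] by simp
qed

end

subsection \<open>Path space\<close>

lemma has_sum_sum: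
  fixes f :: "'a \<Rightarrow> 'b \<Rightarrow> 'c::topological_comm_monoid_add"
  assumes "\<And>g. g \<in> B \<Longrightarrow> ((\<lambda>k. f k g) has_sum s g) A"
  shows "((\<lambda>k. \<Sum>g\<in>B. f k g) has_sum (\<Sum>g\<in>B. s g)) A"
  using assms by (induction B rule: infinite_finite_induct) (auto intro: has_sum_add)

lemma space_path_space [simp]: "space path_space = UNIV"
  by (simp add: path_space_def space_PiM)

lemma space_past_alg [simp]: "space (past_alg n) = UNIV"
  by (simp add: past_alg_def)

lemma sets_past_alg:
  "sets (past_alg n) = sigma_sets UNIV {{x :: int \<Rightarrow> 'g. x m = g} | m g. m < n}"
  by (simp add: past_alg_def)

lemma coordinate_in_path_space: "{x :: int \<Rightarrow> 'g. x m = g} \<in> sets path_space"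
proof -
  have "(\<lambda>x :: int \<Rightarrow> 'g. x m) -` {g} \<inter> space (PiM UNIV (\<lambda>_. count_space UNIV))
      \<in> sets (PiM UNIV (\<lambda>_. count_space UNIV))"
    by (intro measurable_sets[OF measurable_component_singleton]) auto
  then show ?thesis by (simp add: path_space_def vimage_def space_PiM)
qed

lemma coordinate_in_past_alg: "m < n \<Longrightarrow> {x :: int \<Rightarrow> 'g. x m = g} \<in> sets (past_alg n)"
  unfolding sets_past_alg by (intro sigma_sets.Basic) blast

lemma cylinder_in_sets:
  assumes "space M = UNIV" "finite S" "\<And>m g. m \<in> S \<Longrightarrow> {x :: 'i \<Rightarrow> 'g::finite. x m = g} \<in> sets M"
  shows "{x. \<forall>m\<in>S. x m = z m} \<in> sets M"
proof (cases "S = {}")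
  case True
  then show ?thesis using sets.top[of M] assms(1) by simp
next
  case False
  have "{x. \<forall>m\<in>S. x m = z m} = (\<Inter>m\<in>S. {x. x m = z m})" by auto
  then show ?thesis using assms False by (auto intro!: sets.finite_INT)
qed

lemma finite_PiE_UNIV: "finite S \<Longrightarrow> finite (PiE S (\<lambda>_. UNIV :: 'g::finite set))"
  by (intro finite_PiE) auto

text \<open>Over a finite alphabet every preimage is a finite union of cylinders. The measure is
  arbitrary because the lemma is applied both to the whole path space and to the past
  algebra.\<close>

lemma measurable_depends_on:
  fixes F :: "('i \<Rightarrow> 'g::finite) \<Rightarrow> real"
  assumes "space M = UNIV" "finite S" "\<And>m g. m \<in> S \<Longrightarrow> {x. x m = g} \<in> sets M"
    and F: "depends_on S F"
  shows "F \<in> borel_measurable M"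
proof (rule measurableI)
  fix B :: "real set" assume "B \<in> sets borel"
  have "F -` B \<inter> space M = (\<Union>z\<in>{z \<in> PiE S (\<lambda>_. UNIV). F z \<in> B}. {x. \<forall>m\<in>S. x m = z m})"
  proof (intro subset_antisym subsetI)
    fix x assume x: "x \<in> F -` B \<inter> space M"
    have "F (restrict x S) = F x" by (intro depends_onD[OF F]) auto
    then show "x \<in> (\<Union>z\<in>{z \<in> PiE S (\<lambda>_. UNIV). F z \<in> B}. {x. \<forall>m\<in>S. x m = z m})"
      using x by (intro UN_I[of "restrict x S"]) auto
  next
    fix x assume "x \<in> (\<Union>z\<in>{z \<in> PiE S (\<lambda>_. UNIV). F z \<in> B}. {x. \<forall>m\<in>S. x m = z m})"
    then obtain z where z: "F z \<in> B" "\<forall>m\<in>S. x m = z m" by blast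
    then have "F x = F z" by (intro depends_onD[OF F]) auto
    then show "x \<in> F -` B \<inter> space M" using z(1) assms(1) by simp
  qed
  also have "\<dots> \<in> sets M"
    using assms by (intro sets.finite_UN finite_subset[OF _ finite_PiE_UNIV[OF assms(2)]])
      (auto intro!: cylinder_in_sets)
  finally show "F -` B \<inter> space M \<in> sets M" .
qed auto

lemma subalgebra_past:
  fixes \<mu> :: "(int \<Rightarrow> 'g) measure"
  assumes "sets \<mu> = sets path_space"
  shows "subalgebra \<mu> (past_alg n)"
proof -
  have sp: "space \<mu> = UNIV" using sets_eq_imp_space_eq[OF assms] by simp
  have "sigma_sets (space \<mu>) {{x :: int \<Rightarrow> 'g. x m = g} | m g. m < n} \<subseteq> sets \<mu>"
    by (intro sets.sigma_sets_subset) (auto simp: assms coordinate_in_path_space)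
  then show ?thesis by (simp add: subalgebra_def sp sets_past_alg)
qed

section \<open>The kernel as a function of the past, and integrals against compatible laws\<close>

context imitation
begin

abbreviation "p_ker \<equiv> imitation_kernel A \<theta> P"

text \<open>Comparison with \<theta> excludes the default value that the infinite sum in
  \<open>imitation_kernel\<close> would take without summability.\<close>

lemma kernel_has_sum: "((\<lambda>k. \<theta> k * P k (w k) g) has_sum p_ker g w) A"
proof -
  have "\<theta> summable_on A" using theta_prob by (rule has_sum_imp_summable)
  then have "(\<lambda>k. \<theta> k * P k (w k) g) summable_on A"
    by (rule summable_on_comparison_test)
       (auto intro!: mult_left_le mult_nonneg_nonneg theta_nonneg P_nonneg P_le_1)
  then show ?thesis unfolding imitation_kernel_def by (rule has_sum_infsum)
qed

text \<open>The error is uniform in the past: the kernel is a uniform limit of local functions,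
  however heavy the tail of \<theta> is.\<close>

lemma kernel_truncated:
  assumes "finite L" "L \<subseteq> A"
  shows "\<bar>p_ker g w - (\<Sum>k\<in>L. \<theta> k * P k (w k) g)\<bar> \<le> 1 - sum \<theta> L"
  using has_sum_tail_bound[OF kernel_has_sum assms, of w g 1] P_nonneg P_le_1 by simp

lemma kernel_nonneg: "0 \<le> p_ker g w"
  by (rule has_sum_nonneg[OF kernel_has_sum]) (auto intro!: mult_nonneg_nonneg theta_nonneg P_nonneg)

lemma kernel_row: "(\<Sum>g\<in>UNIV. p_ker g w) = 1"
proof -
  have "((\<lambda>k. \<Sum>g\<in>UNIV. \<theta> k * P k (w k) g) has_sum (\<Sum>g\<in>UNIV. p_ker g w)) A"
    by (intro has_sum_sum kernel_has_sum)
  moreover have "((\<lambda>k. \<Sum>g\<in>UNIV. \<theta> k * P k (w k) g) has_sum 1) A \<longleftrightarrow> (\<theta> has_sum 1) A"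
    by (intro has_sum_cong) (simp add: P_row flip: sum_distrib_left)
  ultimately show ?thesis using theta_prob has_sum_unique by blast
qed

lemma kernel_le_1: "p_ker g w \<le> 1"
  using member_le_sum[of g UNIV "\<lambda>g. p_ker g w"] kernel_nonneg kernel_row by simp

lemma kernel_measurable:
  "(\<lambda>x. p_ker g (\<lambda>k. x (n - int k))) \<in> borel_measurable (past_alg n)"
proof (rule borel_measurable_LIMSEQ_real)
  fix x :: "int \<Rightarrow> 'g"
  \<comment> \<open>Extension by 0 off \<open>A\<close> turns the unordered sum into an ordered
    series, since measurability is inherited by limits of sequences.\<close>
  have "((\<lambda>k. if k \<in> A then \<theta> k * P k (x (n - int k)) g else 0) has_sum
      p_ker g (\<lambda>k. x (n - int k))) UNIV"
    using kernel_has_sum[of "\<lambda>k. x (n - int k)" g]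
    by (rule has_sum_cong_neutral[THEN iffD1, rotated -1]) auto
  then show "(\<lambda>N. \<Sum>k<N. if k \<in> A then \<theta> k * P k (x (n - int k)) g else 0)
      \<longlonglongrightarrow> p_ker g (\<lambda>k. x (n - int k))"
    using has_sum_imp_sums sums_def by blast
next
  fix N
  show "(\<lambda>x. \<Sum>k<N. if k \<in> A then \<theta> k * P k (x (n - int k)) g else 0) \<in> borel_measurable (past_alg n)"
  proof (intro borel_measurable_sum)
    fix k
    show "(\<lambda>x. if k \<in> A then \<theta> k * P k (x (n - int k)) g else 0) \<in> borel_measurable (past_alg n)"
    proof (cases "k \<in> A")
      case True
      then have "k > 0" using A_pos by (auto intro: gr0I)
      then show ?thesis
        by (intro measurable_depends_on[where S = "{n - int k}"])
           (auto intro: coordinate_in_past_alg simp: depends_on_def)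
    qed simp
  qed
qed

lemma compatible_prob_space: "compatible p_ker \<mu> \<Longrightarrow> prob_space \<mu>"
  and compatible_sets: "compatible p_ker \<mu> \<Longrightarrow> sets \<mu> = sets path_space"
  by (auto simp: compatible_def)

lemma integrable_local:
  fixes h :: "(int \<Rightarrow> 'g) \<Rightarrow> real"
  assumes \<mu>: "prob_space \<mu>" "sets \<mu> = sets path_space"
    and h: "finite S" "depends_on S h" "\<And>x. \<bar>h x\<bar> \<le> b"
  shows "h \<in> borel_measurable \<mu>" "integrable \<mu> h"
proof -
  interpret prob_space \<mu> by fact
  show m: "h \<in> borel_measurable \<mu>"
    using sets_eq_imp_space_eq[OF \<mu>(2)] h(1,2)
    by (intro measurable_depends_on[where S = S]) (auto simp: \<mu>(2) coordinate_in_path_space)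
  show "integrable \<mu> h"
    by (rule integrable_const_bound[where B = b]) (use h(3) m in auto)
qed

lemma kernel_borel_measurable:
  assumes "sets \<mu> = sets path_space"
  shows "(\<lambda>x. p_ker g (\<lambda>k. x (n - int k))) \<in> borel_measurable \<mu>"
  by (rule measurable_from_subalg[OF subalgebra_past[OF assms] kernel_measurable])

text \<open>Integral and infinite sum are interchanged by means of the uniform truncation error of
  the kernel.\<close>

lemma kernel_integral_has_sum:
  fixes h :: "(int \<Rightarrow> 'g) \<Rightarrow> real"
  assumes \<mu>: "prob_space \<mu>" "sets \<mu> = sets path_space"
    and h: "h \<in> borel_measurable \<mu>" "\<And>x. \<bar>h x\<bar> \<le> b"
  shows "((\<lambda>k. \<theta> k * (\<integral>x. h x * P k (x (n - int k)) g \<partial>\<mu>)) has_sum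
    (\<integral>x. h x * p_ker g (\<lambda>k. x (n - int k)) \<partial>\<mu>)) A"
proof (rule has_sumI_tail_bound)
  interpret prob_space \<mu> by fact
  fix L assume L: "finite L" "L \<subseteq> A"
  have b: "0 \<le> b" using h(2)[of undefined] by linarith
  have Pm: "(\<lambda>x. P k (x (n - int k)) g) \<in> borel_measurable \<mu>" if "k \<in> A" for k
    using that by (intro integrable_local(1)[OF \<mu>, of "{n - int k}" _ 1])
      (auto simp: depends_on_def P_nonneg P_le_1)
  have int_k: "integrable \<mu> (\<lambda>x. h x * P k (x (n - int k)) g)" if "k \<in> A" for k
  proof (rule integrable_const_bound[where B = b])
    show "AE x in \<mu>. norm (h x * P k (x (n - int k)) g) \<le> b"
      using mult_mono[OF h(2) P_le_1[OF that]] that b by (auto simp: abs_mult P_nonneg)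
  qed (use h(1) Pm[OF that] in measurable)
  have km: "(\<lambda>x. p_ker g (\<lambda>k. x (n - int k))) \<in> borel_measurable \<mu>"
    by (rule kernel_borel_measurable[OF \<mu>(2)])
  have int_p: "integrable \<mu> (\<lambda>x. h x * p_ker g (\<lambda>k. x (n - int k)))"
  proof (rule integrable_const_bound[where B = b])
    show "AE x in \<mu>. norm (h x * p_ker g (\<lambda>k. x (n - int k))) \<le> b"
      using mult_mono[OF h(2) kernel_le_1] b by (auto simp: abs_mult kernel_nonneg)
  qed (use h(1) km in measurable)
  have int_L: "integrable \<mu> (\<lambda>x. \<theta> k * (h x * P k (x (n - int k)) g))" if "k \<in> L" for k
    using int_k L that by auto
  have "(\<Sum>k\<in>L. \<theta> k * (\<integral>x. h x * P k (x (n - int k)) g \<partial>\<mu>))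
      = (\<integral>x. (\<Sum>k\<in>L. \<theta> k * (h x * P k (x (n - int k)) g)) \<partial>\<mu>)"
    using int_L by (simp add: Bochner_Integration.integral_sum)
  then have "(\<integral>x. h x * p_ker g (\<lambda>k. x (n - int k)) \<partial>\<mu>)
      - (\<Sum>k\<in>L. \<theta> k * (\<integral>x. h x * P k (x (n - int k)) g \<partial>\<mu>))
      = (\<integral>x. h x * p_ker g (\<lambda>k. x (n - int k)) - (\<Sum>k\<in>L. \<theta> k * (h x * P k (x (n - int k)) g)) \<partial>\<mu>)"
    using int_p int_L by (simp add: Bochner_Integration.integral_diff)
  also have "\<dots> = (\<integral>x. h x * (p_ker g (\<lambda>k. x (n - int k)) - (\<Sum>k\<in>L. \<theta> k * P k (x (n - int k)) g)) \<partial>\<mu>)"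
    by (simp add: right_diff_distrib sum_distrib_left mult.left_commute)
  also have "\<bar>\<dots>\<bar> \<le> (\<integral>x. b * (1 - sum \<theta> L) \<partial>\<mu>)"
  proof (rule integral_abs_bound[THEN order_trans], rule integral_mono')
    fix x
    show "\<bar>h x * (p_ker g (\<lambda>k. x (n - int k)) - (\<Sum>k\<in>L. \<theta> k * P k (x (n - int k)) g))\<bar>
        \<le> b * (1 - sum \<theta> L)"
      unfolding abs_mult
      by (rule mult_mono[OF h(2) kernel_truncated[OF L, where w = "\<lambda>k. x (n - int k)"] b abs_ge_zero])
  qed (use b theta_sum_le_1[OF L] in auto)
  finally show "\<bar>(\<integral>x. h x * p_ker g (\<lambda>k. x (n - int k)) \<partial>\<mu>)
      - (\<Sum>k\<in>L. \<theta> k * (\<integral>x. h x * P k (x (n - int k)) g \<partial>\<mu>))\<bar> \<le> b * (1 - sum \<theta> L)"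
    by (simp add: prob_space)
qed

text \<open>Conditional probabilities tested against local functions of the past. Only
  finite-dimensional distributions occur here, and the uniqueness proof uses compatibility in no
  other form.\<close>

lemma compatible_step:
  fixes h :: "(int \<Rightarrow> 'g) \<Rightarrow> real"
  assumes comp: "compatible p_ker \<mu>"
    and h: "finite S" "depends_on S h" "\<And>m. m \<in> S \<Longrightarrow> m < n" "\<And>x. \<bar>h x\<bar> \<le> b"
  shows "((\<lambda>k. \<theta> k * (\<integral>x. h x * P k (x (n - int k)) g \<partial>\<mu>)) has_sum
    (\<integral>x. h x * indicator {x. x n = g} x \<partial>\<mu>)) A"
proof -
  note \<mu> = compatible_prob_space[OF comp] compatible_sets[OF comp]
  interpret prob_space \<mu> by (rule \<mu>(1))
  interpret finite_measure_subalgebra \<mu> "past_alg n"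
    by unfold_locales (rule subalgebra_past[OF \<mu>(2)])
  have hm: "h \<in> borel_measurable (past_alg n)"
    using h by (intro measurable_depends_on[where S = S]) (auto intro: coordinate_in_past_alg)
  have hm': "h \<in> borel_measurable \<mu>" by (rule integrable_local(1)[OF \<mu> h(1,2,4)])
  have ind: "(indicator {x :: int \<Rightarrow> 'g. x n = g} :: _ \<Rightarrow> real) \<in> borel_measurable \<mu>"
    using coordinate_in_path_space[of n g] by (intro borel_measurable_indicator) (simp add: \<mu>(2))
  have "integrable \<mu> (\<lambda>x. h x * indicator {x. x n = g} x)"
  proof (rule integrable_const_bound[where B = b])
    show "AE x in \<mu>. norm (h x * indicator {x. x n = g} x) \<le> b"
      using h(4) order_trans[OF abs_ge_zero h(4)] by (auto simp: indicator_def)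
  qed (rule borel_measurable_times[OF hm' ind])
  from real_cond_exp_intg(2)[OF this hm ind]
  have "(\<integral>x. h x * indicator {x. x n = g} x \<partial>\<mu>)
      = (\<integral>x. h x * real_cond_exp \<mu> (past_alg n) (indicator {x. x n = g}) x \<partial>\<mu>)" ..
  also have "\<dots> = (\<integral>x. h x * p_ker g (\<lambda>k. x (n - int k)) \<partial>\<mu>)"
  proof (rule integral_cong_AE)
    have "AE x in \<mu>. real_cond_exp \<mu> (past_alg n) (indicator {x. x n = g}) x
        = p_ker g (\<lambda>k. x (n - int k))"
      using comp by (simp add: compatible_def)
    then show "AE x in \<mu>. h x * real_cond_exp \<mu> (past_alg n) (indicator {x. x n = g}) x
        = h x * p_ker g (\<lambda>k. x (n - int k))"
      by eventually_elim simp
  qed (use hm' kernel_borel_measurable[OF \<mu>(2)] in measurable)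
  finally show ?thesis using kernel_integral_has_sum[OF \<mu> hm' h(4)] by simp
qed

section \<open>Duality for compatible laws and uniqueness\<close>

definition expect :: "(int \<Rightarrow> 'g) measure \<Rightarrow> ('i \<Rightarrow> int) \<Rightarrow> (('i \<Rightarrow> 'g) \<Rightarrow> real) \<Rightarrow> real" where
  "expect \<mu> p F = (\<integral>x. F (\<lambda>i. x (p i)) \<partial>\<mu>)"

lemma depends_on_reindex:
  "depends_on I F \<Longrightarrow> depends_on (p ` I) (\<lambda>x. F (\<lambda>i. x (p i)))"
  by (auto simp: depends_on_def)

lemma finite_depends_on_bounded:
  fixes F :: "('i \<Rightarrow> 'g) \<Rightarrow> real"
  assumes "finite I" "depends_on I F"
  shows "\<exists>b. \<forall>y. \<bar>F y\<bar> \<le> b"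
proof -
  have "F y \<in> F ` PiE I (\<lambda>_. UNIV)" for y
    by (rule image_eqI[of _ _ "restrict y I"]) (auto intro: depends_onD[OF assms(2)])
  then have "\<bar>F y\<bar> \<le> Max (abs ` F ` PiE I (\<lambda>_. UNIV))" for y
    by (intro Max_ge finite_imageI finite_PiE_UNIV assms(1)) blast
  then show ?thesis by blast
qed

lemma expect_integrable:
  fixes F :: "('i \<Rightarrow> 'g) \<Rightarrow> real"
  assumes "compatible p_ker \<mu>" "finite I" "depends_on I F"
  shows "integrable \<mu> (\<lambda>x. F (\<lambda>i. x (p i)))"
proof -
  obtain b where "\<And>y. \<bar>F y\<bar> \<le> b" using finite_depends_on_bounded[OF assms(2,3)] by blast
  then show ?thesis
    using assms depends_on_reindex[OF assms(3), of p]
    by (intro integrable_local(2)[OF compatible_prob_space compatible_sets, of _ "p ` I" _ b]) auto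
qed

text \<open>All other sites precede the top one, so \<open>F\<close> with the type of
  \<open>i\<close> frozen to \<open>g\<close> is a function of the past of that site; summing over
  \<open>g\<close> recovers \<open>F\<close>. Sites are labels with movable positions, so the
  ancestor may land on another site.\<close>

lemma expect_top:
  fixes F :: "('i \<Rightarrow> 'g) \<Rightarrow> real"
  assumes comp: "compatible p_ker \<mu>" and I: "finite I" "i \<in> I" and F: "depends_on I F"
    and top: "\<And>j. j \<in> I - {i} \<Longrightarrow> p j < p i"
  shows "((\<lambda>k. \<theta> k * expect \<mu> (p(i := p i - int k)) (act i (P k) F)) has_sum expect \<mu> p F) A"
proof -
  note \<mu> = compatible_prob_space[OF comp] compatible_sets[OF comp]
  interpret prob_space \<mu> by (rule \<mu>(1))
  obtain b where b: "\<And>y. \<bar>F y\<bar> \<le> b" using finite_depends_on_bounded[OF I(1) F] by blast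
  define h where "h g x = F ((\<lambda>j. x (p j))(i := g))" for g and x :: "int \<Rightarrow> 'g"
  have h_dep: "depends_on (p ` (I - {i})) (h g)" for g
    unfolding h_def depends_on_def by (auto intro!: depends_onD[OF F])
  have fin: "finite (p ` (I - {i}))" using I by simp
  have h_bd: "\<bar>h g x\<bar> \<le> b" for g x by (simp add: h_def b)
  have step: "((\<lambda>k. \<theta> k * (\<integral>x. h g x * P k (x (p i - int k)) g \<partial>\<mu>)) has_sum
      (\<integral>x. h g x * indicator {x. x (p i) = g} x \<partial>\<mu>)) A" for g
    using top by (intro compatible_step[OF comp fin h_dep _ h_bd]) auto
  have sum: "((\<lambda>k. \<Sum>g\<in>UNIV. \<theta> k * (\<integral>x. h g x * P k (x (p i - int k)) g \<partial>\<mu>)) has_sum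
      (\<Sum>g\<in>UNIV. \<integral>x. h g x * indicator {x. x (p i) = g} x \<partial>\<mu>)) A"
    by (intro has_sum_sum step)
  have limit: "(\<Sum>g\<in>UNIV. \<integral>x. h g x * indicator {x. x (p i) = g} x \<partial>\<mu>) = expect \<mu> p F"
  proof -
    have "integrable \<mu> (\<lambda>x. h g x * indicator {x. x (p i) = g} x)" for g
      using I h_dep[of g] h_bd order_trans[OF abs_ge_zero h_bd]
      by (intro integrable_local(2)[OF \<mu>, of "p ` I" _ b])
         (auto simp: depends_on_def indicator_def)
    then have "(\<Sum>g\<in>UNIV. \<integral>x. h g x * indicator {x. x (p i) = g} x \<partial>\<mu>)
        = (\<integral>x. (\<Sum>g\<in>UNIV. h g x * indicator {x. x (p i) = g} x) \<partial>\<mu>)"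
      by (rule Bochner_Integration.integral_sum[symmetric])
    also have "(\<lambda>x. \<Sum>g\<in>UNIV. h g x * indicator {x. x (p i) = g} x) = (\<lambda>x. F (\<lambda>j. x (p j)))"
      by (rule ext) (simp add: indicator_def h_def if_distrib[of "\<lambda>c. _ * c"] cong: if_cong,
          auto intro!: arg_cong[of _ _ F])
    finally show ?thesis by (simp add: expect_def)
  qed
  have summand: "(\<Sum>g\<in>UNIV. \<theta> k * (\<integral>x. h g x * P k (x (p i - int k)) g \<partial>\<mu>))
      = \<theta> k * expect \<mu> (p(i := p i - int k)) (act i (P k) F)" if k: "k \<in> A" for k
  proof -
    have "integrable \<mu> (\<lambda>x. P k (x (p i - int k)) g * h g x)" for g
    proof (rule integrable_local(2)[OF \<mu>, of "insert (p i - int k) (p ` I)" _ b])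
      show "depends_on (insert (p i - int k) (p ` I)) (\<lambda>x. P k (x (p i - int k)) g * h g x)"
        using h_dep[of g] by (auto simp: depends_on_def)
      show "\<bar>P k (x (p i - int k)) g * h g x\<bar> \<le> b" for x
        using mult_mono[OF P_le_1[OF k] h_bd] k by (auto simp: abs_mult P_nonneg)
    qed (use I in auto)
    then have "(\<Sum>g\<in>UNIV. \<integral>x. P k (x (p i - int k)) g * h g x \<partial>\<mu>)
        = (\<integral>x. (\<Sum>g\<in>UNIV. P k (x (p i - int k)) g * h g x) \<partial>\<mu>)"
      by (simp add: Bochner_Integration.integral_sum)
    also have "\<dots> = expect \<mu> (p(i := p i - int k)) (act i (P k) F)"
    proof -
      have "(\<lambda>j. x ((p(i := p i - int k)) j))(i := g) = (\<lambda>j. x (p j))(i := g)"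
        for x :: "int \<Rightarrow> 'g" and g by auto
      then show ?thesis by (simp add: expect_def act_def h_def)
    qed
    finally show ?thesis by (simp add: sum_distrib_left[symmetric] mult.commute[of "h _ _"])
  qed
  show ?thesis
    using sum unfolding limit by (rule has_sum_cong[THEN iffD1, rotated]) (rule summand)
qed

text \<open>Induction over proper subsets supplies the degenerate cases of the duality: functions
  that ignore a site, and positions that coincide, where one label is redundant. The shift
  \<open>c\<close> is harmless since the kernel is the same at all times; \<open>c = 0\<close> gives
  uniqueness, and equal laws give stationarity.\<close>

lemma expect_unique:
  fixes F :: "('i \<Rightarrow> 'g) \<Rightarrow> real"
  assumes comp: "compatible p_ker \<mu>" "compatible p_ker \<nu>" and ap: "aperiodic_sf A P"
    and I: "finite I" and F: "depends_on I F"
  shows "expect \<mu> p F = expect \<nu> (\<lambda>i. p i + c) F"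
  using I F
proof (induction I arbitrary: p F rule: finite_psubset_induct)
  case (psubset I)
  interpret \<mu>: prob_space \<mu> by (rule compatible_prob_space[OF comp(1)])
  interpret \<nu>: prob_space \<nu> by (rule compatible_prob_space[OF comp(2)])
  define D where "D p F = expect \<mu> p F - expect \<nu> (\<lambda>i. p i + c) F" for p :: "'i \<Rightarrow> int" and F :: "('i \<Rightarrow> 'g) \<Rightarrow> real"
  note int = expect_integrable[OF comp(1) psubset.hyps] expect_integrable[OF comp(2) psubset.hyps]
  show ?case
  proof (cases "I = {}")
    case True
    then have "F y = F undefined" for y using psubset.prems by (auto intro: depends_onD)
    then have "expect \<mu> p F = (\<integral>x. F undefined \<partial>\<mu>)" "expect \<nu> (\<lambda>i. p i + c) F = (\<integral>x. F undefined \<partial>\<nu>)"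
      unfolding expect_def by metis+
    then show ?thesis by (simp add: \<mu>.prob_space \<nu>.prob_space)
  next
    case False
    have marg: "D p G = 0" if "i \<in> I" "depends_on (I - {i}) G" for p :: "'i \<Rightarrow> int" and G i
      using psubset.IH[of "I - {i}" G p] that by (auto simp: D_def)
    interpret signed_duality A \<theta> P I D 2
    proof unfold_locales
      show "D p G = 0" if "i \<in> I" "depends_on (I - {i}) G" for p :: "'i \<Rightarrow> int" and G i
        by (rule marg[OF that])
    next
      fix p :: "'i \<Rightarrow> int" and G :: "('i \<Rightarrow> 'g) \<Rightarrow> real" assume G: "depends_on I G" "\<not> inj_on p I"
      then obtain i j where ij: "i \<in> I" "j \<in> I" "i \<noteq> j" "p i = p j" by (auto simp: inj_on_def)
      \<comment> \<open>The type of \<open>i\<close> is read off at \<open>j\<close>, which has the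
        same position. The expectations do not change, but the label \<open>i\<close> is no longer
        used.\<close>
      define G' where "G' y = G (y(i := y j))" for y
      have "G' (\<lambda>k. x (p k)) = G (\<lambda>k. x (p k))" "G' (\<lambda>k. x (p k + c)) = G (\<lambda>k. x (p k + c))"
        for x :: "int \<Rightarrow> 'g"
        unfolding G'_def using ij(4) by (auto intro!: arg_cong[of _ _ G])
      then have "D p G = D p G'" by (simp add: D_def expect_def)
      also have "\<dots> = 0"
      proof (rule marg[OF ij(1)])
        show "depends_on (I - {i}) G'"
          unfolding G'_def depends_on_def using ij by (auto intro!: depends_onD[OF G(1)])
      qed
      finally show "D p G = 0" .
    next
      fix p :: "'i \<Rightarrow> int" and i and G :: "('i \<Rightarrow> 'g) \<Rightarrow> real"
      assume G: "depends_on I G" "i \<in> I" "\<And>j. j \<in> I - {i} \<Longrightarrow> p j < p i"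
      have "(\<lambda>j. (p(i := p i - int k)) j + c) = (\<lambda>j. p j + c)(i := (p i + c) - int k)" for k
        by auto
      then have "((\<lambda>k. \<theta> k * expect \<nu> (\<lambda>j. (p(i := p i - int k)) j + c) (act i (P k) G)) has_sum
          expect \<nu> (\<lambda>j. p j + c) G) A"
        using expect_top[OF comp(2) psubset.hyps(1) G(2,1), of "\<lambda>j. p j + c"] G(3) by simp
      from has_sum_add[OF expect_top[where p = p, OF comp(1) psubset.hyps(1) G(2,1,3)]
          has_sum_cmult_right[OF this, of "- 1"]]
      show "((\<lambda>k. \<theta> k * D (p(i := p i - int k)) (act i (P k) G)) has_sum D p G) A"
        by (simp add: D_def right_diff_distrib)
    next
      fix p :: "'i \<Rightarrow> int" and G H :: "('i \<Rightarrow> 'g) \<Rightarrow> real" assume "depends_on I G" "depends_on I H"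
      then show "D p (\<lambda>y. G y + H y) = D p G + D p H"
        using int[of G] int[of H] by (simp add: D_def expect_def)
    next
      fix p :: "'i \<Rightarrow> int" and c and G :: "('i \<Rightarrow> 'g) \<Rightarrow> real" assume "depends_on I G"
      show "D p (\<lambda>y. c * G y) = c * D p G"
        by (simp add: D_def expect_def right_diff_distrib)
    next
      fix p :: "'i \<Rightarrow> int" and G :: "('i \<Rightarrow> 'g) \<Rightarrow> real" assume G: "depends_on I G" "\<And>y. \<bar>G y\<bar> \<le> 1"
      have "\<bar>expect \<mu> p G\<bar> \<le> (\<integral>x. 1 \<partial>\<mu>)" unfolding expect_def
        using G(2) by (intro integral_abs_bound[THEN order_trans] integral_mono') auto
      moreover have "\<bar>expect \<nu> (\<lambda>i. p i + c) G\<bar> \<le> (\<integral>x. 1 \<partial>\<nu>)" unfolding expect_def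
        using G(2) by (intro integral_abs_bound[THEN order_trans] integral_mono') auto
      ultimately show "\<bar>D p G\<bar> \<le> 2" by (simp add: D_def \<mu>.prob_space \<nu>.prob_space)
    qed (rule psubset.hyps(1))
    obtain b where "\<And>y. \<bar>F y\<bar> \<le> b"
      using finite_depends_on_bounded[OF psubset.hyps(1) psubset.prems] by blast
    from D_vanishes[OF ap False psubset.prems this, of p] show ?thesis by (simp add: D_def)
  qed
qed

lemma compatible_unique:
  assumes comp: "compatible p_ker \<mu>" "compatible p_ker \<nu>" and ap: "aperiodic_sf A P"
  shows "\<mu> = \<nu>"
proof -
  interpret \<mu>: prob_space \<mu> by (rule compatible_prob_space[OF comp(1)])
  interpret \<nu>: prob_space \<nu> by (rule compatible_prob_space[OF comp(2)])
  show ?thesis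
  proof (rule measure_eqI_PiM_infinite[where I = UNIV and M = "\<lambda>_. count_space UNIV"])
    show "sets \<mu> = sets (PiM UNIV (\<lambda>_. count_space UNIV))"
      "sets \<nu> = sets (PiM UNIV (\<lambda>_. count_space UNIV))"
      using compatible_sets[OF comp(1)] compatible_sets[OF comp(2)] by (auto simp: path_space_def)
    show "finite_measure \<mu>" by unfold_locales
  next
    fix B and J :: "int set" assume J: "finite J"
    define Z where "Z = {x :: int \<Rightarrow> 'g. \<forall>i\<in>J. x i \<in> B i}"
    have Z: "prod_emb UNIV (\<lambda>_. count_space UNIV) J (Pi\<^sub>E J B) = Z"
      by (auto simp: prod_emb_def Z_def PiE_iff space_PiM)
    have dep: "depends_on J (indicator Z :: _ \<Rightarrow> real)"
      by (auto simp: depends_on_def Z_def indicator_def)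
    have "Z \<in> sets \<mu>" "Z \<in> sets \<nu>"
    proof -
      have "Z \<in> sets path_space"
        using J by (auto simp flip: Z simp: path_space_def intro!: sets_PiM_I)
      then show "Z \<in> sets \<mu>" "Z \<in> sets \<nu>" using comp compatible_sets by auto
    qed
    \<comment> \<open>Sites serve as their own labels here, with shift 0.\<close>
    then have "measure \<mu> Z = measure \<nu> Z"
      using expect_unique[OF comp ap J dep, of "\<lambda>i. i" 0] by (simp add: expect_def)
    then show "emeasure \<mu> (prod_emb UNIV (\<lambda>_. count_space UNIV) J (Pi\<^sub>E J B))
        = emeasure \<nu> (prod_emb UNIV (\<lambda>_. count_space UNIV) J (Pi\<^sub>E J B))"
      by (simp add: Z \<mu>.emeasure_eq_measure \<nu>.emeasure_eq_measure)
  qed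
qed

end

subsection \<open>Positive functionals on local functions\<close>

definition cyl :: "'i set \<Rightarrow> ('i \<Rightarrow> 'g) \<Rightarrow> ('i \<Rightarrow> 'g) set" where
  "cyl J z = {x. \<forall>i\<in>J. x i = z i}"

lemma depends_on_cyl: "depends_on J (indicator (cyl J z) :: _ \<Rightarrow> real)"
  by (auto simp: depends_on_def cyl_def indicator_def)

text \<open>Extensional assignments give one representative per pattern on \<open>S\<close>, so
  exactly the term of \<open>restrict x S\<close> survives.\<close>

lemma local_decomp:
  fixes F :: "('i \<Rightarrow> 'g::finite) \<Rightarrow> real"
  assumes "finite S" "depends_on S F"
  shows "F x = (\<Sum>z\<in>PiE S (\<lambda>_. UNIV). F z * indicator (cyl S z) x)"
proof -
  have "F z * indicator (cyl S z) x = (if z = restrict x S then F x else 0)"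
    if z: "z \<in> PiE S (\<lambda>_. UNIV)" for z
  proof (cases "z = restrict x S")
    case True
    then have "x \<in> cyl S z" by (simp add: cyl_def)
    moreover have "F z = F x" using True by (intro depends_onD[OF assms(2)]) simp
    ultimately show ?thesis using True by simp
  next
    case False
    then obtain i where "i \<in> S" "z i \<noteq> x i" using z by (metis PiE_restrict restrict_ext)
    then have "x \<notin> cyl S z" unfolding cyl_def by force
    then show ?thesis using False by simp
  qed
  then have "(\<Sum>z\<in>PiE S (\<lambda>_. UNIV). F z * indicator (cyl S z) x)
      = (\<Sum>z\<in>PiE S (\<lambda>_. UNIV). if z = restrict x S then F x else 0)"
    by (intro sum.cong) auto
  also have "\<dots> = F x" by (subst sum.delta[OF finite_PiE_UNIV[OF assms(1)]]) simp
  finally show ?thesis ..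
qed

text \<open>Sequential compactness of a countable product of finite sets: along a diagonal
  subsequence every coordinate is eventually constant, and a local set recognises the limit from
  finitely many coordinates.\<close>

lemma compact_product_nonempty_Inter:
  fixes Z :: "nat \<Rightarrow> ('i::countable \<Rightarrow> 'g::finite) set"
  assumes ne: "\<And>n. Z n \<noteq> {}" and dec: "decseq Z"
    and loc: "\<And>n. finite (J n)" "\<And>n. depends_on (J n) (\<lambda>x. x \<in> Z n)"
  shows "(\<Inter>n. Z n) \<noteq> {}"
proof -
  define x where "x n = (SOME y. y \<in> Z n)" for n
  have x: "x n \<in> Z n" for n using ne by (simp add: x_def some_in_eq)
  \<comment> \<open>Letters are coded by naturals so that the diagonal principle for bounded real
    functions applies; distinct codes differ by at least 1, so convergent means eventually
    constant.\<close>
  define e where "e = (\<lambda>g :: 'g. real (to_nat g))"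
  have e_inj: "e g = e h \<longleftrightarrow> g = h" for g h by (simp add: e_def)
  define M where "M = Max (range e)"
  have M: "norm (e (x n i)) \<le> M" for n i
    unfolding M_def by (simp add: e_def)
  obtain k where k: "strict_mono (k :: nat \<Rightarrow> nat)"
    and conv: "\<And>i. \<exists>l. (\<lambda>n. e (x (k n) i)) \<longlonglongrightarrow> l"
    using function_convergent_subsequence[of "UNIV :: 'i set" "\<lambda>n i. e (x n i)" M, OF countableI_type M]
    by (metis UNIV_I)
  have "\<exists>g. \<forall>\<^sub>F n in sequentially. x (k n) i = g" for i
  proof -
    obtain l where l: "(\<lambda>n. e (x (k n) i)) \<longlonglongrightarrow> l" using conv by blast
    then have "Cauchy (\<lambda>n. e (x (k n) i))" by (rule LIMSEQ_imp_Cauchy)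
    then obtain N where N: "\<forall>m\<ge>N. \<forall>n\<ge>N. dist (e (x (k m) i)) (e (x (k n) i)) < 1"
      unfolding Cauchy_def by (metis zero_less_one)
    have "x (k n) i = x (k N) i" if "n \<ge> N" for n
    proof -
      have "\<bar>real (to_nat (x (k n) i)) - real (to_nat (x (k N) i))\<bar> < 1"
        using N that by (simp add: e_def dist_real_def)
      then have "to_nat (x (k n) i) = to_nat (x (k N) i)" by linarith
      then show ?thesis by simp
    qed
    then show ?thesis by (auto simp: eventually_sequentially)
  qed
  then obtain y where y: "\<And>i. \<forall>\<^sub>F n in sequentially. x (k n) i = y i" by metis
  have "y \<in> Z n" for n
  proof -
    have "\<forall>\<^sub>F m in sequentially. \<forall>i\<in>J n. x (k m) i = y i"
      using y loc(1) by (auto intro: eventually_ball_finite)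
    moreover have "\<forall>\<^sub>F m in sequentially. n \<le> m" by (rule eventually_ge_at_top)
    ultimately have "\<forall>\<^sub>F m in sequentially. n \<le> m \<and> (\<forall>i\<in>J n. x (k m) i = y i)"
      by eventually_elim simp
    then obtain m where m: "n \<le> m" "\<forall>i\<in>J n. x (k m) i = y i"
      by (auto dest: eventually_happens)
    have "n \<le> k m" using m(1) seq_suble[OF k, of m] by linarith
    then have "x (k m) \<in> Z n" using x dec by (auto simp: decseq_def)
    then show ?thesis using depends_onD[OF loc(2), of n "x (k m)" y] m(2) by simp
  qed
  then show ?thesis by blast
qed

text \<open>Kolmogorov extension in functional form. Finite-dimensional laws read off from a single
  functional are automatically consistent, and compactness supplies countable additivity.\<close>

lemma finite_alphabet_extension:
  fixes \<Phi> :: "(('i::countable \<Rightarrow> 'g::finite) \<Rightarrow> real) \<Rightarrow> real"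
  assumes add: "\<And>S F G. finite S \<Longrightarrow> depends_on S F \<Longrightarrow> depends_on S G \<Longrightarrow>
      \<Phi> (\<lambda>x. F x + G x) = \<Phi> F + \<Phi> G"
    and scale: "\<And>S F c. finite S \<Longrightarrow> depends_on S F \<Longrightarrow> \<Phi> (\<lambda>x. c * F x) = c * \<Phi> F"
    and nonneg: "\<And>S F. finite S \<Longrightarrow> depends_on S F \<Longrightarrow> (\<And>x. 0 \<le> F x) \<Longrightarrow> 0 \<le> \<Phi> F"
    and one: "\<Phi> (\<lambda>x. 1) = 1"
  shows "\<exists>\<mu>. prob_space \<mu> \<and> sets \<mu> = sets (PiM UNIV (\<lambda>_. count_space UNIV)) \<and>
    (\<forall>S F. finite S \<longrightarrow> depends_on S F \<longrightarrow> \<Phi> F = (\<integral>x. F x \<partial>\<mu>))"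
proof -
  have sum: "\<Phi> (\<lambda>x. \<Sum>z\<in>B. c z * F z x) = (\<Sum>z\<in>B. c z * \<Phi> (F z))"
    if S: "finite S" and B: "finite B" "\<And>z. z \<in> B \<Longrightarrow> depends_on S (F z)"
    for S B c and F :: "'z \<Rightarrow> ('i \<Rightarrow> 'g) \<Rightarrow> real"
    using B
  proof (induction B)
    case empty
    show ?case using scale[of "{}" "\<lambda>x. 1" 0] by (simp add: depends_on_def)
  next
    case (insert z B)
    have 1: "depends_on S (\<lambda>x. c z * F z x)"
      using insert.prems[of z] by (auto simp: depends_on_def)
    have 2: "depends_on S (\<lambda>x. \<Sum>z\<in>B. c z * F z x)"
      unfolding depends_on_def
    proof (intro allI impI sum.cong refl)
      fix x y :: "'i \<Rightarrow> 'g" and j assume "\<forall>i\<in>S. x i = y i" "j \<in> B"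
      then show "c j * F j x = c j * F j y"
        using insert.prems[of j] depends_onD[of S "F j" x y] by simp
    qed
    show ?case using insert add[OF S 1 2] scale[OF S, of "F z" "c z"] by simp
  qed
  define w where "w J z = \<Phi> (indicator (cyl J z))" for J z
  have w_nonneg: "0 \<le> w J z" if "finite J" for J z
    unfolding w_def using that by (intro nonneg[OF _ depends_on_cyl]) auto
  let ?M = "\<lambda>_ :: 'i. count_space (UNIV :: 'g set)"
  let ?X = "\<lambda>J :: 'i set. PiE J (\<lambda>_. UNIV :: 'g set)"
  define Q where "Q J = point_measure (?X J) (\<lambda>z. ennreal (w J z))" for J
  have PiM_eq: "PiM J ?M = count_space (?X J)" if "finite J" for J
    using that by (intro count_space_PiM_finite) auto
  have sets_Q: "sets (Q J) = Pow (?X J)" "space (Q J) = ?X J" for J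
    by (auto simp: Q_def sets_point_measure space_point_measure)
  have Q_eq: "emeasure (Q J) B = ennreal (\<Sum>z\<in>B. w J z)" if "finite J" "B \<subseteq> ?X J" for J B
    unfolding Q_def emeasure_point_measure_finite[OF finite_PiE_UNIV[OF that(1)] that(2)]
    by (rule sum_ennreal) (rule w_nonneg[OF that(1)])
  have total: "(\<Sum>z\<in>?X J. w J z) = 1" if J: "finite J" for J
  proof -
    have eq: "(\<lambda>x. 1) = (\<lambda>x. \<Sum>z\<in>?X J. 1 * indicator (cyl J z) x :: real)"
      by (rule ext, rule local_decomp[OF J]) (simp add: depends_on_def)
    have "1 = \<Phi> (\<lambda>x. \<Sum>z\<in>?X J. 1 * indicator (cyl J z) x)"
      unfolding eq[symmetric] by (rule one[symmetric])
    also have "\<dots> = (\<Sum>z\<in>?X J. 1 * w J z)"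
      unfolding w_def by (rule sum[OF J finite_PiE_UNIV[OF J] depends_on_cyl])
    finally show ?thesis by simp
  qed
  interpret projective_family UNIV Q ?M
  proof (rule projective_family.intro)
    fix J H :: "'i set" assume JH: "J \<subseteq> H" "finite H"
    then have J: "finite J" by (rule finite_subset)
    have restr: "(\<lambda>f. restrict f J) \<in> measurable (Q H) (PiM J ?M)"
      by (auto simp: Q_def space_PiM)
    show "Q J = distr (Q H) (PiM J ?M) (\<lambda>f. restrict f J)"
    proof (rule measure_eqI_finite)
      show "sets (Q J) = Pow (?X J)" by (rule sets_Q)
      show "sets (distr (Q H) (PiM J ?M) (\<lambda>f. restrict f J)) = Pow (?X J)" using PiM_eq[OF J] by simp
      show "finite (?X J)" using J by (rule finite_PiE_UNIV)
      fix z assume z: "z \<in> ?X J"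
      let ?Y = "{y \<in> ?X H. restrict y J = z}"
      \<comment> \<open>Consistency: the cylinder over \<open>J\<close> is the disjoint union of the
        cylinders over \<open>H\<close> whose pattern restricts to \<open>z\<close>.\<close>
      have "indicator (cyl J z) x = (\<Sum>y\<in>?Y. 1 * indicator (cyl H y) x :: real)" for x
      proof -
        have "indicator (cyl J z) x = (\<Sum>y\<in>?X H. indicator (cyl J z) y * indicator (cyl H y) x :: real)"
          using JH by (intro local_decomp depends_on_mono[OF depends_on_cyl])
        also have "\<dots> = (\<Sum>y\<in>?Y. indicator (cyl J z) y * indicator (cyl H y) x)"
        proof (rule sum.mono_neutral_right[OF finite_PiE_UNIV[OF JH(2)]])
          show "\<forall>y\<in>?X H - ?Y. indicator (cyl J z) y * indicator (cyl H y) x = (0 :: real)"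
          proof
            fix y assume y: "y \<in> ?X H - ?Y"
            have "y \<notin> cyl J z"
            proof
              assume "y \<in> cyl J z"
              then have "restrict y J = restrict z J" by (auto simp: cyl_def)
              then show False using y z by (simp add: PiE_restrict)
            qed
            then show "indicator (cyl J z) y * indicator (cyl H y) x = (0 :: real)" by simp
          qed
        qed auto
        also have "\<dots> = (\<Sum>y\<in>?Y. 1 * indicator (cyl H y) x)"
          by (intro sum.cong) (auto simp: cyl_def)
        finally show ?thesis .
      qed
      then have "w J z = \<Phi> (\<lambda>x. \<Sum>y\<in>?Y. 1 * indicator (cyl H y) x)"
        unfolding w_def by presburger
      also have "\<dots> = (\<Sum>y\<in>?Y. 1 * w H y)"
        unfolding w_def
        by (rule sum[OF JH(2) _ depends_on_cyl]) (use finite_PiE_UNIV[OF JH(2)] in auto)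
      finally have w_eq: "w J z = (\<Sum>y\<in>?Y. w H y)" by simp
      have "(\<lambda>f. restrict f J) -` {z} \<inter> space (Q H) = ?Y" by (auto simp: sets_Q)
      then have "emeasure (distr (Q H) (PiM J ?M) (\<lambda>f. restrict f J)) {z} = emeasure (Q H) ?Y"
        using z PiM_eq[OF J] by (subst emeasure_distr[OF restr]) auto
      also have "\<dots> = ennreal (w J z)" using JH(2) by (subst Q_eq) (auto simp: w_eq)
      also have "\<dots> = emeasure (Q J) {z}" using J z by (subst Q_eq) auto
      finally show "emeasure (Q J) {z} = emeasure (distr (Q H) (PiM J ?M) (\<lambda>f. restrict f J)) {z}" ..
    qed
  next
    fix J :: "'i set" assume J: "finite J"
    show "prob_space (Q J)"
      by (rule prob_spaceI) (simp add: sets_Q Q_eq[OF J] total[OF J])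
  qed
  have emb_eq: "emb UNIV J X = {x. restrict x J \<in> X}" for J and X :: "('i \<Rightarrow> 'g) set"
    by (auto simp: prod_emb_def space_PiM)
  \<comment> \<open>What has to be checked is continuity at the empty set: decreasing cylinders with
    mass bounded away from 0 are nonempty, hence have a common point.\<close>
  have lim_emb: "emeasure lim (emb UNIV J X) = Q J X" if J: "finite J" "X \<in> sets (PiM J ?M)" for J X
  proof (rule emeasure_lim[OF J(1) _ J(2)])
    fix J :: "nat \<Rightarrow> 'i set" and X
    assume JX: "\<And>i. finite (J i)" "decseq (\<lambda>i. emb UNIV (J i) (X i))"
      and sets: "\<And>i. X i \<in> sets (PiM (J i) ?M)" and INF: "0 < (INF i. Q (J i) (X i))"
    show "(\<Inter>i. emb UNIV (J i) (X i)) \<noteq> {}"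
    proof (rule compact_product_nonempty_Inter[OF _ JX(2,1)])
      fix n
      have "0 < Q (J n) (X n)" using INF by (meson INF_lower UNIV_I order_less_le_trans)
      then have "X n \<noteq> {}" by auto
      moreover have "X n \<subseteq> ?X (J n)" using sets[of n] PiM_eq[OF JX(1)] by simp
      ultimately obtain z where "z \<in> X n" "z \<in> ?X (J n)" by blast
      then show "emb UNIV (J n) (X n) \<noteq> {}"
        using PiE_restrict[of z "J n"] by (auto simp: emb_eq intro!: exI[of _ z])
      show "depends_on (J n) (\<lambda>x. x \<in> emb UNIV (J n) (X n))"
        unfolding depends_on_def emb_eq by (metis mem_Collect_eq restrict_ext)
    qed
  qed simp
  have cyl_emb: "cyl J z = emb UNIV J {z}" if "z \<in> ?X J" for J z
    unfolding emb_eq cyl_def using that by (auto simp: fun_eq_iff PiE_iff extensional_def)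
  have lim_cyl: "emeasure lim (cyl J z) = ennreal (w J z)" if "finite J" "z \<in> ?X J" for J z
    using that lim_emb[of J "{z}"] PiM_eq[OF that(1)] by (simp add: cyl_emb Q_eq)
  have cyl_sets: "cyl J z \<in> sets lim" if "finite J" "z \<in> ?X J" for J z
    using that PiM_eq[OF that(1)] measurable_prod_emb[of J UNIV "{z}" ?M] by (simp add: cyl_emb)
  interpret L: prob_space lim
  proof (rule prob_spaceI)
    have "space lim = cyl {} (\<lambda>_. undefined)" by (simp add: space_PiM cyl_def)
    then show "emeasure lim (space lim) = 1"
      using lim_cyl[of "{}" "\<lambda>_. undefined"] total[of "{}"] by simp
  qed
  have "\<Phi> F = (\<integral>x. F x \<partial>lim)" if S: "finite S" and F: "depends_on S F" for S F
  proof -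
    have eq: "F = (\<lambda>x. \<Sum>z\<in>?X S. F z * indicator (cyl S z) x)"
      by (rule ext) (rule local_decomp[OF S F])
    have "(\<integral>x. F x \<partial>lim) = (\<integral>x. (\<Sum>z\<in>?X S. F z * indicator (cyl S z) x) \<partial>lim)"
      by (rule Bochner_Integration.integral_cong[OF refl local_decomp[OF S F]])
    also have "\<dots> = (\<Sum>z\<in>?X S. \<integral>x. F z * indicator (cyl S z) x \<partial>lim)"
      using S cyl_sets
      by (intro Bochner_Integration.integral_sum integrable_mult_right)
         (auto simp: L.emeasure_eq_measure)
    also have "\<dots> = (\<Sum>z\<in>?X S. F z * w S z)"
    proof (intro sum.cong refl)
      fix z assume z: "z \<in> ?X S"
      have "measure lim (cyl S z) = w S z"
        using lim_cyl[OF S z] w_nonneg[OF S] by (simp add: measure_def)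
      then show "(\<integral>x. F z * indicator (cyl S z) x \<partial>lim) = F z * w S z"
        using cyl_sets[OF S z] by simp
    qed
    also have "\<dots> = \<Phi> (\<lambda>x. \<Sum>z\<in>?X S. F z * indicator (cyl S z) x)"
      unfolding w_def by (rule sum[OF S finite_PiE_UNIV[OF S] depends_on_cyl, symmetric])
    also have "\<dots> = \<Phi> F" by (rule arg_cong[of _ _ \<Phi>, OF eq[symmetric]])
    finally show ?thesis ..
  qed
  then show ?thesis using L.prob_space_axioms by (intro exI[of _ lim]) auto
qed

context imitation
begin

subsection \<open>Resampling from a fixed distant past\<close>

definition step :: "int \<Rightarrow> ((int \<Rightarrow> 'g) \<Rightarrow> real) \<Rightarrow> (int \<Rightarrow> 'g) \<Rightarrow> real" where
  "step n f x = (\<Sum>g\<in>UNIV. p_ker g (\<lambda>k. x (n - int k)) * f (x(n := g)))"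

text \<open>The sites n, n - 1, ..., n - j + 1 are integrated out from the latest to the earliest,
  so that each kernel reads coordinates not yet integrated.\<close>

primrec steps :: "nat \<Rightarrow> int \<Rightarrow> ((int \<Rightarrow> 'g) \<Rightarrow> real) \<Rightarrow> (int \<Rightarrow> 'g) \<Rightarrow> real" where
  "steps 0 n f = f"
| "steps (Suc j) n f = steps j (n - 1) (step n f)"

lemma steps_add: "steps j n (\<lambda>x. f x + g x) x = steps j n f x + steps j n g x"
proof (induction j arbitrary: n f g)
  case (Suc j)
  have "step n (\<lambda>x. f x + g x) = (\<lambda>x. step n f x + step n g x)"
    by (rule ext) (simp add: step_def distrib_left sum.distrib)
  then show ?case by (simp add: Suc)
qed simp

lemma steps_scale: "steps j n (\<lambda>x. c * f x) x = c * steps j n f x"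
proof (induction j arbitrary: n f)
  case (Suc j)
  have "step n (\<lambda>x. c * f x) = (\<lambda>x. c * step n f x)"
    by (rule ext) (simp add: step_def sum_distrib_left mult.left_commute)
  then show ?case by (simp add: Suc)
qed simp

lemma steps_nonneg: "(\<And>x. 0 \<le> f x) \<Longrightarrow> 0 \<le> steps j n f x"
proof (induction j arbitrary: n f)
  case (Suc j)
  then have "0 \<le> step n f x" for x
    by (auto simp: step_def intro!: sum_nonneg mult_nonneg_nonneg kernel_nonneg)
  then show ?case by (simp add: Suc.IH)
qed simp

lemma steps_const: "steps j n (\<lambda>x. c) x = c"
proof (induction j arbitrary: n)
  case (Suc j)
  have "step n (\<lambda>x. c) = (\<lambda>x. c)"
    by (rule ext) (simp add: step_def kernel_row flip: sum_distrib_right)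
  then show ?case by (simp add: Suc)
qed simp

lemma steps_bound:
  assumes "\<And>x. \<bar>f x\<bar> \<le> b"
  shows "\<bar>steps j n f x\<bar> \<le> b"
proof -
  have pos: "0 \<le> b + f y" "0 \<le> b + (- 1) * f y" for y using assms[of y] by linarith+
  have "0 \<le> steps j n (\<lambda>x. b + f x) x" by (rule steps_nonneg) (rule pos)
  moreover have "0 \<le> steps j n (\<lambda>x. b + (- 1) * f x) x" by (rule steps_nonneg) (rule pos)
  ultimately show ?thesis unfolding steps_add steps_scale steps_const by linarith
qed

lemma steps_sum: "finite L \<Longrightarrow> steps j n (\<lambda>x. \<Sum>k\<in>L. c k * f k x) x = (\<Sum>k\<in>L. c k * steps j n (f k) x)"
  by (induction L rule: finite_induct) (simp_all add: steps_const steps_add steps_scale)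

lemma step_trivial:
  assumes "depends_on {..n} f" "n < m"
  shows "step m f = f"
proof
  fix x
  have "f (x(m := g)) = f x" for g
    using assms(2) by (intro depends_onD[OF assms(1)]) auto
  then show "step m f x = f x"
    by (simp add: step_def kernel_row flip: sum_distrib_right)
qed

lemma kernel_cong: "(\<And>k. k \<in> A \<Longrightarrow> w k = v k) \<Longrightarrow> p_ker g w = p_ker g v"
  unfolding imitation_kernel_def by (rule infsum_cong) simp

lemma depends_on_step:
  assumes "depends_on {..n} f"
  shows "depends_on {..n - 1} (step n f)"
  unfolding depends_on_def step_def
proof (intro allI impI sum.cong refl arg_cong2[where f = "(*)"])
  fix x y :: "int \<Rightarrow> 'g" and g assume xy: "\<forall>i\<in>{..n - 1}. x i = y i"
  show "p_ker g (\<lambda>k. x (n - int k)) = p_ker g (\<lambda>k. y (n - int k))"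
  proof (rule kernel_cong)
    fix k assume "k \<in> A"
    then have "k > 0" using A_pos by (auto intro: gr0I)
    then show "x (n - int k) = y (n - int k)" using xy by simp
  qed
  show "f (x(n := g)) = f (y(n := g))"
    using xy by (intro depends_onD[OF assms]) auto
qed

lemma steps_skip: "depends_on {..n} f \<Longrightarrow> steps (i + j) (n + int i) f = steps j n f"
proof (induction i)
  case (Suc i)
  have "step (n + int (Suc i)) f = f" by (rule step_trivial[OF Suc.prems]) simp
  then have "steps (Suc i + j) (n + int (Suc i)) f = steps (i + j) (n + int (Suc i) - 1) f" by simp
  also have "n + int (Suc i) - 1 = n + int i" by simp
  finally show ?case using Suc by simp
qed simp

text \<open>Expectation for the chain run over the 2 * N + 1 sites from -N to N. The past is frozen
  at \<open>undefined\<close>, an arbitrary configuration; a functional suffices here, and a measure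
  is built only after the limit.\<close>

definition approx :: "nat \<Rightarrow> ((int \<Rightarrow> 'g) \<Rightarrow> real) \<Rightarrow> real" where
  "approx N f = steps (2 * N + 1) (int N) f undefined"

lemma approx_add: "approx N (\<lambda>x. f x + g x) = approx N f + approx N g"
  and approx_scale: "approx N (\<lambda>x. c * f x) = c * approx N f"
  and approx_sum: "finite L \<Longrightarrow> approx N (\<lambda>x. \<Sum>k\<in>L. d k * F k x) = (\<Sum>k\<in>L. d k * approx N (F k))"
  and approx_const: "approx N (\<lambda>x. c) = c"
  and approx_nonneg: "(\<And>x. 0 \<le> f x) \<Longrightarrow> 0 \<le> approx N f"
  and approx_bound: "(\<And>x. \<bar>f x\<bar> \<le> b) \<Longrightarrow> \<bar>approx N f\<bar> \<le> b"
  unfolding approx_def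
  by (fact steps_add steps_scale steps_sum steps_const steps_nonneg steps_bound)+

text \<open>The tower property: sites after \<open>n\<close> are integrated out trivially, so the
  first effective operation is \<open>step n\<close> itself. The bound on \<open>N\<close> says that
  \<open>n\<close> is among the resampled sites.\<close>

lemma approx_step:
  assumes "depends_on {..n} f" "nat \<bar>n\<bar> \<le> N"
  shows "approx N (step n f) = approx N f"
proof -
  define i j where "i = nat (int N - n)" and "j = nat (int N + n)"
  have ij: "2 * N + 1 = i + Suc j" "int N = n + int i"
    using assms(2) by (auto simp: i_def j_def)
  have "approx N f = steps (i + Suc j) (n + int i) f undefined"
    unfolding approx_def ij(1) by (simp only: ij(2))
  also have "\<dots> = steps j (n - 1) (step n f) undefined"
    unfolding steps_skip[OF assms(1)] by simp
  also have "\<dots> = steps (Suc i + j) (n - 1 + int (Suc i)) (step n f) undefined"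
    by (rule fun_cong[OF steps_skip[OF depends_on_step[OF assms(1)], symmetric]])
  also have "Suc i + j = 2 * N + 1" using ij(1) by simp
  also have "n - 1 + int (Suc i) = int N" using ij(2) by simp
  finally show ?thesis by (simp add: approx_def)
qed

text \<open>The kernel is not local, so convergence on local functions does not apply to it
  directly. Truncation turns compatibility into an inequality between finitely many local functions,
  uniform in \<open>N\<close>.\<close>

lemma approx_truncated:
  fixes h :: "(int \<Rightarrow> 'g) \<Rightarrow> real"
  assumes h: "depends_on S h" "\<And>m. m \<in> S \<Longrightarrow> m < n" "\<And>x. \<bar>h x\<bar> \<le> b"
    and L: "finite L" "L \<subseteq> A" and N: "nat \<bar>n\<bar> \<le> N"
  shows "\<bar>approx N (\<lambda>x. h x * indicator {x. x n = g} x)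
      - (\<Sum>k\<in>L. \<theta> k * approx N (\<lambda>x. h x * P k (x (n - int k)) g))\<bar> \<le> b * (1 - sum \<theta> L)"
proof -
  let ?f = "\<lambda>x. h x * indicator {x. x n = g} x :: real"
  have "0 \<le> b" using h(3)[of undefined] by linarith
  have dep: "depends_on {..n} ?f"
    unfolding depends_on_def
  proof (intro allI impI)
    fix x y :: "int \<Rightarrow> 'g" assume xy: "\<forall>i\<in>{..n}. x i = y i"
    then have "h x = h y" using h(2) by (intro depends_onD[OF h(1)]) force
    then show "?f x = ?f y" using xy by (simp add: indicator_def)
  qed
  have step_f: "step n ?f = (\<lambda>x. h x * p_ker g (\<lambda>k. x (n - int k)))"
  proof
    fix x
    have "h (x(n := g')) = h x" for g'
      using h(2) by (intro depends_onD[OF h(1)]) force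
    then have "step n ?f x = (\<Sum>g'\<in>UNIV. if g' = g then h x * p_ker g (\<lambda>k. x (n - int k)) else 0)"
      unfolding step_def by (intro sum.cong) (auto simp: indicator_def)
    then show "step n ?f x = h x * p_ker g (\<lambda>k. x (n - int k))" by simp
  qed
  have "approx N ?f - (\<Sum>k\<in>L. \<theta> k * approx N (\<lambda>x. h x * P k (x (n - int k)) g))
      = approx N (\<lambda>x. h x * p_ker g (\<lambda>k. x (n - int k))
          + (- 1) * (\<Sum>k\<in>L. \<theta> k * (h x * P k (x (n - int k)) g)))"
    unfolding approx_step[OF dep N, symmetric] step_f
    by (simp only: approx_add approx_scale approx_sum[OF L(1)])
  also have "(\<lambda>x. h x * p_ker g (\<lambda>k. x (n - int k))
          + (- 1) * (\<Sum>k\<in>L. \<theta> k * (h x * P k (x (n - int k)) g)))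
      = (\<lambda>x. h x * (p_ker g (\<lambda>k. x (n - int k)) - (\<Sum>k\<in>L. \<theta> k * P k (x (n - int k)) g)))"
    by (rule ext) (simp add: right_diff_distrib sum_distrib_left sum_negf mult.left_commute)
  also have "\<bar>approx N \<dots>\<bar> \<le> b * (1 - sum \<theta> L)"
  proof (rule approx_bound)
    fix x
    show "\<bar>h x * (p_ker g (\<lambda>k. x (n - int k)) - (\<Sum>k\<in>L. \<theta> k * P k (x (n - int k)) g))\<bar>
        \<le> b * (1 - sum \<theta> L)"
      unfolding abs_mult
      by (rule mult_mono[OF h(3) kernel_truncated[OF L, where w = "\<lambda>k. x (n - int k)"] \<open>0 \<le> b\<close> abs_ge_zero])
  qed
  finally show ?thesis .
qed

text \<open>There are only countably many cylinders, so a diagonal argument handles their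
  indicators, and every local function is a finite combination of them.\<close>

lemma approx_convergent_subsequence:
  "\<exists>r. strict_mono (r :: nat \<Rightarrow> nat) \<and>
    (\<forall>S f. finite S \<longrightarrow> depends_on S f \<longrightarrow> convergent (\<lambda>m. approx (r m) f))"
proof -
  define I where "I = (SIGMA S : {S :: int set. finite S}. PiE S (\<lambda>_. UNIV :: 'g set))"
  define e where "e N = (\<lambda>(S, z). approx N (indicator (cyl S z)))" for N
  have "countable I"
    unfolding I_def
    by (intro countable_SIGMA countable_Collect_finite) (auto intro: countable_finite finite_PiE_UNIV)
  moreover have "norm (e N u) \<le> 1" for N u
    by (auto simp: e_def indicator_def split: prod.splits intro!: approx_bound)
  ultimately obtain r where r: "strict_mono (r :: nat \<Rightarrow> nat)"
    "\<And>u. u \<in> I \<Longrightarrow> \<exists>l. (\<lambda>m. e (r m) u) \<longlonglongrightarrow> l"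
    using function_convergent_subsequence[of I e 1] by blast
  have "convergent (\<lambda>m. approx (r m) f)" if S: "finite S" "depends_on S f" for S f
  proof -
    have f: "f = (\<lambda>x. \<Sum>z\<in>PiE S (\<lambda>_. UNIV). f z * indicator (cyl S z) x)"
      by (rule ext) (rule local_decomp[OF S])
    have eq: "approx N f = (\<Sum>z\<in>PiE S (\<lambda>_. UNIV). f z * approx N (indicator (cyl S z)))" for N
      by (rule trans[OF arg_cong[of _ _ "approx N", OF f]])
         (rule approx_sum[OF finite_PiE_UNIV[OF S(1)]])
    have "convergent (\<lambda>m. approx (r m) (indicator (cyl S z)))" if "z \<in> PiE S (\<lambda>_. UNIV)" for z
      using r(2)[of "(S, z)"] that S(1) by (simp add: I_def e_def convergent_def)
    then show ?thesis unfolding eq by (intro convergent_sum convergent_mult[OF convergent_const])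
  qed
  then show ?thesis using r(1) by blast
qed

text \<open>The truncated inequalities survive the limit and identify the left integral as a sum
  over letters; the right integral has the same expansion, and sums are unique.\<close>

lemma limit_law_exists:
  "\<exists>\<mu>. prob_space \<mu> \<and> sets \<mu> = sets path_space \<and>
    (\<forall>S h b n g. finite S \<longrightarrow> depends_on S h \<longrightarrow> (\<forall>m\<in>S. m < n) \<longrightarrow> (\<forall>x. \<bar>h x\<bar> \<le> b) \<longrightarrow>
      (\<integral>x. h x * indicator {x. x n = g} x \<partial>\<mu>) = (\<integral>x. h x * p_ker g (\<lambda>k. x (n - int k)) \<partial>\<mu>))"
proof -
  obtain r where r: "strict_mono (r :: nat \<Rightarrow> nat)"
    and conv: "\<And>S f. finite S \<Longrightarrow> depends_on S f \<Longrightarrow> convergent (\<lambda>m. approx (r m) f)"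
    using approx_convergent_subsequence by blast
  define \<Phi> where "\<Phi> f = lim (\<lambda>m. approx (r m) f)" for f
  have lim: "(\<lambda>m. approx (r m) f) \<longlonglongrightarrow> \<Phi> f" if "finite S" "depends_on S f" for S f
    using conv[OF that] by (simp add: \<Phi>_def convergent_LIMSEQ_iff)
  have "\<exists>\<mu>. prob_space \<mu> \<and> sets \<mu> = sets (PiM UNIV (\<lambda>_. count_space UNIV)) \<and>
      (\<forall>S F. finite S \<longrightarrow> depends_on S F \<longrightarrow> \<Phi> F = (\<integral>x. F x \<partial>\<mu>))"
  proof (rule finite_alphabet_extension)
    fix S and F G :: "(int \<Rightarrow> 'g) \<Rightarrow> real"
    assume S: "finite S" "depends_on S F" "depends_on S G"
    have "(\<lambda>m. approx (r m) (\<lambda>x. F x + G x)) \<longlonglongrightarrow> \<Phi> F + \<Phi> G"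
      using tendsto_add[OF lim[OF S(1,2)] lim[OF S(1,3)]] by (simp add: approx_add)
    then show "\<Phi> (\<lambda>x. F x + G x) = \<Phi> F + \<Phi> G" unfolding \<Phi>_def by (rule limI)
  next
    fix S c and F :: "(int \<Rightarrow> 'g) \<Rightarrow> real"
    assume S: "finite S" "depends_on S F"
    have "(\<lambda>m. approx (r m) (\<lambda>x. c * F x)) \<longlonglongrightarrow> c * \<Phi> F"
      using tendsto_mult_left[OF lim[OF S], of c] by (simp add: approx_scale)
    then show "\<Phi> (\<lambda>x. c * F x) = c * \<Phi> F" unfolding \<Phi>_def by (rule limI)
  next
    fix S and F :: "(int \<Rightarrow> 'g) \<Rightarrow> real"
    assume S: "finite S" "depends_on S F" "\<And>x. 0 \<le> F x"
    then show "0 \<le> \<Phi> F"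
      by (intro LIMSEQ_le_const[OF lim[OF S(1,2)]]) (auto intro!: approx_nonneg)
  next
    show "\<Phi> (\<lambda>x. 1) = 1" by (simp add: \<Phi>_def approx_const)
  qed
  then obtain \<mu> where \<mu>: "prob_space \<mu>" "sets \<mu> = sets path_space"
    and \<Phi>: "\<And>S F. finite S \<Longrightarrow> depends_on S F \<Longrightarrow> \<Phi> F = (\<integral>x. F x \<partial>\<mu>)"
    by (auto simp: path_space_def)
  have "(\<integral>x. h x * indicator {x. x n = g} x \<partial>\<mu>) = (\<integral>x. h x * p_ker g (\<lambda>k. x (n - int k)) \<partial>\<mu>)"
    if h: "finite S" "depends_on S h" "\<forall>m\<in>S. m < n" "\<forall>x. \<bar>h x\<bar> \<le> b" for S h b n g
  proof -
    let ?f = "\<lambda>x. h x * indicator {x. x n = g} x :: real"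
    let ?h = "\<lambda>k x. h x * P k (x (n - int k)) g"
    have f: "finite (insert n S)" "depends_on (insert n S) ?f"
      using h(1,2) by (auto simp: depends_on_def indicator_def)
    have hk: "finite (insert (n - int k) S)" "depends_on (insert (n - int k) S) (?h k)" for k
      using h(1,2) by (auto simp: depends_on_def)
    have "((\<lambda>k. \<theta> k * (\<integral>x. ?h k x \<partial>\<mu>)) has_sum (\<integral>x. ?f x \<partial>\<mu>)) A"
    proof (rule has_sumI_tail_bound)
      fix L assume L: "finite L" "L \<subseteq> A"
      have "(\<lambda>m. \<bar>approx (r m) ?f - (\<Sum>k\<in>L. \<theta> k * approx (r m) (?h k))\<bar>)
          \<longlonglongrightarrow> \<bar>\<Phi> ?f - (\<Sum>k\<in>L. \<theta> k * \<Phi> (?h k))\<bar>"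
        by (intro tendsto_intros lim[OF f] lim[OF hk])
      moreover have "\<bar>approx (r m) ?f - (\<Sum>k\<in>L. \<theta> k * approx (r m) (?h k))\<bar> \<le> b * (1 - sum \<theta> L)"
        if "m \<ge> nat \<bar>n\<bar>" for m
        \<comment> \<open>A strictly increasing \<open>r\<close> satisfies
          \<open>m \<le> r m\<close>, so site \<open>n\<close> is within the resampled
          range.\<close>
        using that seq_suble[OF r, of m] h by (intro approx_truncated[OF h(2) _ _ L]) auto
      ultimately have "\<bar>\<Phi> ?f - (\<Sum>k\<in>L. \<theta> k * \<Phi> (?h k))\<bar> \<le> b * (1 - sum \<theta> L)"
        by (intro LIMSEQ_le_const2) blast+
      then show "\<bar>(\<integral>x. ?f x \<partial>\<mu>) - (\<Sum>k\<in>L. \<theta> k * (\<integral>x. ?h k x \<partial>\<mu>))\<bar> \<le> b * (1 - sum \<theta> L)"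
        by (simp only: \<Phi>[OF f] \<Phi>[OF hk])
    qed
    moreover have "((\<lambda>k. \<theta> k * (\<integral>x. ?h k x \<partial>\<mu>)) has_sum
        (\<integral>x. h x * p_ker g (\<lambda>k. x (n - int k)) \<partial>\<mu>)) A"
      using h by (intro kernel_integral_has_sum[OF \<mu>] integrable_local(1)[OF \<mu>, of S h b]) auto
    ultimately show ?thesis by (rule has_sum_unique)
  qed
  then show ?thesis using \<mu> by blast
qed

text \<open>The identity is known on events of the past that depend on finitely many sites. They
  form a generating \<pi>-system, and Dynkin's argument extends it to the whole past algebra, which
  characterises the conditional expectation.\<close>

lemma compatible_exists: "\<exists>\<mu>. compatible p_ker \<mu>"
proof -
  obtain \<mu> where \<mu>: "prob_space \<mu>" "sets \<mu> = sets path_space"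
    and local_eq: "\<And>S h b n g. finite S \<Longrightarrow> depends_on S h \<Longrightarrow> \<forall>m\<in>S. m < n \<Longrightarrow> \<forall>x. \<bar>h x\<bar> \<le> b \<Longrightarrow>
      (\<integral>x. h x * indicator {x. x n = g} x \<partial>\<mu>) = (\<integral>x. h x * p_ker g (\<lambda>k. x (n - int k)) \<partial>\<mu>)"
    using limit_law_exists by blast
  interpret prob_space \<mu> by (rule \<mu>(1))
  have sp: "space \<mu> = UNIV" using sets_eq_imp_space_eq[OF \<mu>(2)] by simp
  have "AE x in \<mu>. real_cond_exp \<mu> (past_alg n) (indicator {y. y n = g}) x
      = p_ker g (\<lambda>k. x (n - int k))" for n g
  proof -
    interpret finite_measure_subalgebra \<mu> "past_alg n"
      by unfold_locales (rule subalgebra_past[OF \<mu>(2)])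
    let ?f = "indicator {y. y n = g} :: (int \<Rightarrow> 'g) \<Rightarrow> real"
    let ?q = "\<lambda>x. p_ker g (\<lambda>k. x (n - int k))"
    have int_f: "integrable \<mu> ?f"
      using coordinate_in_path_space[of n g] by (simp add: \<mu>(2) emeasure_eq_measure)
    have int_q: "integrable \<mu> ?q"
      by (rule integrable_const_bound[where B = 1])
         (auto simp: kernel_nonneg kernel_le_1 intro: kernel_borel_measurable[OF \<mu>(2)])
    define G where "G = {B. \<exists>S. finite S \<and> (\<forall>m\<in>S. m < n) \<and> depends_on S (\<lambda>x :: int \<Rightarrow> 'g. x \<in> B)}"
    have G_Int: "Int_stable G"
    proof (rule Int_stableI)
      fix B C assume "B \<in> G" "C \<in> G"
      then obtain S T where S: "finite S" "\<forall>m\<in>S. m < n" "depends_on S (\<lambda>x. x \<in> B)"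
        and T: "finite T" "\<forall>m\<in>T. m < n" "depends_on T (\<lambda>x. x \<in> C)" by (auto simp: G_def)
      have "depends_on (S \<union> T) (\<lambda>x. x \<in> B \<inter> C)"
        unfolding depends_on_def
      proof (intro allI impI)
        fix x y :: "int \<Rightarrow> 'g" assume "\<forall>i\<in>S \<union> T. x i = y i"
        then have "(x \<in> B) = (y \<in> B)" "(x \<in> C) = (y \<in> C)"
          using depends_onD[OF S(3), of x y] depends_onD[OF T(3), of x y] by auto
        then show "(x \<in> B \<inter> C) = (y \<in> B \<inter> C)" by simp
      qed
      then show "B \<inter> C \<in> G"
        unfolding G_def using S T by (intro CollectI exI[of _ "S \<union> T"]) auto
    qed
    have G_past: "G \<subseteq> sets (past_alg n)"
    proof
      fix B assume "B \<in> G"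
      then obtain S where S: "finite S" "\<forall>m\<in>S. m < n" "depends_on S (\<lambda>x. x \<in> B)" by (auto simp: G_def)
      have "(indicator B :: _ \<Rightarrow> real) \<in> borel_measurable (past_alg n)"
        using S by (intro measurable_depends_on[where S = S])
          (auto intro: coordinate_in_past_alg simp: depends_on_def indicator_def)
      then show "B \<in> sets (past_alg n)" by (simp add: borel_measurable_indicator_iff)
    qed
    have past_G: "sets (past_alg n) \<subseteq> sigma_sets UNIV G"
      unfolding sets_past_alg
    proof (rule sigma_sets_mono', rule subsetI)
      fix B :: "(int \<Rightarrow> 'g) set" assume "B \<in> {{x. x m = g} | m g. m < n}"
      then obtain m h where "B = {x. x m = h}" "m < n" by blast
      then show "B \<in> G" unfolding G_def by (intro CollectI exI[of _ "{m}"]) (auto simp: depends_on_def)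
    qed
    have G_sets: "sigma_sets UNIV G \<subseteq> sets \<mu>"
      using G_past subalgebra_past[OF \<mu>(2), of n] sp sets.sigma_sets_subset[of G \<mu>]
      by (auto simp: subalgebra_def)
    have eq: "(LINT x:B|\<mu>. ?f x) = (LINT x:B|\<mu>. ?q x)" if "B \<in> sigma_sets UNIV G" for B
    proof (rule sigma_sets_induct_disjoint[OF G_Int _ that])
      fix B assume "B \<in> G"
      then obtain S where S: "finite S" "\<forall>m\<in>S. m < n" "depends_on S (\<lambda>x. x \<in> B)" by (auto simp: G_def)
      have "depends_on S (indicator B :: _ \<Rightarrow> real)"
        using S(3) by (auto simp: depends_on_def indicator_def)
      from local_eq[OF S(1) this S(2), of 1 g]
      show "(LINT x:B|\<mu>. ?f x) = (LINT x:B|\<mu>. ?q x)"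
        by (simp add: set_lebesgue_integral_def indicator_def)
    next
      fix B assume B: "B \<in> sigma_sets UNIV G" "(LINT x:B|\<mu>. ?f x) = (LINT x:B|\<mu>. ?q x)"
      have Bm: "B \<in> sets \<mu>" "UNIV - B \<in> sets \<mu>"
        using B(1) G_sets sets.compl_sets[of B \<mu>] sp by auto
      have split: "(LINT x|\<mu>. u x) = (LINT x:B|\<mu>. u x) + (LINT x:UNIV - B|\<mu>. u x)"
        if "integrable \<mu> u" for u :: "_ \<Rightarrow> real"
        using set_integral_Un[of B "UNIV - B" \<mu> u]
          integrable_mult_indicator[OF Bm(1) that] integrable_mult_indicator[OF Bm(2) that]
        by (simp add: set_integrable_def set_lebesgue_integral_def)
      \<comment> \<open>The total integrals agree by the local identity with no sites and test
        function 1, so complements follow by subtraction.\<close>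
      have "(LINT x|\<mu>. ?f x) = (LINT x|\<mu>. ?q x)"
        using local_eq[of "{}" "\<lambda>_. 1" n 1 g] by (simp add: depends_on_def)
      then show "(LINT x:UNIV - B|\<mu>. ?f x) = (LINT x:UNIV - B|\<mu>. ?q x)"
        using split[OF int_f] split[OF int_q] B(2) by simp
    next
      fix B :: "nat \<Rightarrow> (int \<Rightarrow> 'g) set"
      assume B: "disjoint_family B" "range B \<subseteq> sigma_sets UNIV G"
        "\<And>i. (LINT x:B i|\<mu>. ?f x) = (LINT x:B i|\<mu>. ?q x)"
      have Bm: "B i \<in> sets \<mu>" for i using B(2) G_sets by blast
      have "(LINT x:(\<Union>i. B i)|\<mu>. u x) = (\<Sum>i. LINT x:B i|\<mu>. u x)" if "integrable \<mu> u"
        for u :: "_ \<Rightarrow> real"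
      proof (rule lebesgue_integral_countable_add)
        show "set_integrable \<mu> (\<Union>i. B i) u"
          unfolding set_integrable_def by (rule integrable_mult_indicator[OF _ that]) (use Bm in auto)
      qed (use B(1) Bm in \<open>auto simp: disjoint_family_on_def\<close>)
      then show "(LINT x:(\<Union>i. B i)|\<mu>. ?f x) = (LINT x:(\<Union>i. B i)|\<mu>. ?q x)"
        using int_f int_q B(3) by simp
    qed (auto simp: set_lebesgue_integral_def)
    show ?thesis
      by (rule real_cond_exp_charact[OF _ int_f int_q kernel_measurable]) (use eq past_G in blast)
  qed
  then show ?thesis using \<mu> by (auto simp: compatible_def)
qed

subsection \<open>The single-site marginal\<close>

lemma avg_mat_has_sum: "((\<lambda>k. \<theta> k * P k i j) has_sum avg_mat A \<theta> P i j) A"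
  using kernel_has_sum[of "\<lambda>_. i" j] by (simp add: imitation_kernel_def avg_mat_def)

lemma invariant_distr_has_sum:
  assumes "invariant_distr (avg_mat A \<theta> P) l"
  shows "((\<lambda>k. \<theta> k * (\<Sum>i\<in>UNIV. l i * P k i j)) has_sum l j) A"
proof -
  have "((\<lambda>k. \<Sum>i\<in>UNIV. l i * (\<theta> k * P k i j)) has_sum (\<Sum>i\<in>UNIV. l i * avg_mat A \<theta> P i j)) A"
    by (intro has_sum_sum has_sum_cmult_right avg_mat_has_sum)
  also have "(\<Sum>i\<in>UNIV. l i * avg_mat A \<theta> P i j) = l j"
    using assms by (simp add: invariant_distr_def)
  finally show ?thesis by (simp add: sum_distrib_left mult.left_commute)
qed

lemma invariant_distr_unique:
  assumes ap: "aperiodic_sf A P"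
    and l: "invariant_distr (avg_mat A \<theta> P) l" and l': "invariant_distr (avg_mat A \<theta> P) l'"
  shows "l = l'"
proof -
  \<comment> \<open>Positions are ignored, as an invariant distribution is the same at all times:
    \<open>D_top\<close> then says invariance, injectivity cannot fail on one site, and functions
    that ignore the site are killed because both masses are 1.\<close>
  define D :: "(unit \<Rightarrow> int) \<Rightarrow> ((unit \<Rightarrow> 'g) \<Rightarrow> real) \<Rightarrow> real"
    where "D p F = (\<Sum>g\<in>UNIV. (l g - l' g) * F (\<lambda>_. g))" for p F
  interpret signed_duality A \<theta> P "UNIV :: unit set" D "\<Sum>g\<in>UNIV. \<bar>l g - l' g\<bar>"
  proof unfold_locales
    fix p F i assume "i \<in> (UNIV :: unit set)" "depends_on (UNIV - {i}) (F :: (unit \<Rightarrow> 'g) \<Rightarrow> real)"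
    then have "F (\<lambda>_. g) = F undefined" for g
      by (intro depends_onD[of "UNIV - {i}" F]) auto
    then have "D p F = (\<Sum>g\<in>UNIV. l g - l' g) * F undefined"
      by (simp add: D_def sum_distrib_right)
    also have "(\<Sum>g\<in>UNIV. l g - l' g) = 0"
      using l l' by (simp add: sum_subtractf invariant_distr_def)
    finally show "D p F = 0" by simp
  next
    fix p i and F :: "(unit \<Rightarrow> 'g) \<Rightarrow> real"
    have upd: "(\<lambda>_ :: unit. g)(() := h) = (\<lambda>_. h)" for g h :: 'g by (auto simp: fun_eq_iff)
    have d: "((\<lambda>k. \<theta> k * (\<Sum>g\<in>UNIV. (l g - l' g) * P k g h)) has_sum (l h - l' h)) A" for h
      using has_sum_add[OF invariant_distr_has_sum[OF l, of h]
          has_sum_cmult_right[OF invariant_distr_has_sum[OF l', of h], of "- 1"]]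
      by (simp add: left_diff_distrib sum_subtractf right_diff_distrib)
    have "((\<lambda>k. \<Sum>h\<in>UNIV. \<theta> k * (\<Sum>g\<in>UNIV. (l g - l' g) * P k g h) * F (\<lambda>_. h)) has_sum D p F) A"
      unfolding D_def by (intro has_sum_sum has_sum_cmult_left d)
    also have "(\<lambda>k. \<Sum>h\<in>UNIV. \<theta> k * (\<Sum>g\<in>UNIV. (l g - l' g) * P k g h) * F (\<lambda>_. h))
        = (\<lambda>k. \<theta> k * D (p(i := p i - int k)) (act i (P k) F))"
    proof
      fix k
      have "(\<Sum>h\<in>UNIV. \<theta> k * (\<Sum>g\<in>UNIV. (l g - l' g) * P k g h) * F (\<lambda>_. h))
          = \<theta> k * (\<Sum>h\<in>UNIV. \<Sum>g\<in>UNIV. (l g - l' g) * (P k g h * F (\<lambda>_. h)))"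
        by (simp add: sum_distrib_left sum_distrib_right mult.assoc)
      also have "\<dots> = \<theta> k * D (p(i := p i - int k)) (act i (P k) F)"
        by (subst sum.swap) (simp add: D_def act_def upd sum_distrib_left)
      finally show "(\<Sum>h\<in>UNIV. \<theta> k * (\<Sum>g\<in>UNIV. (l g - l' g) * P k g h) * F (\<lambda>_. h))
          = \<theta> k * D (p(i := p i - int k)) (act i (P k) F)" .
    qed
    finally show "((\<lambda>k. \<theta> k * D (p(i := p i - int k)) (act i (P k) F)) has_sum D p F) A" .
  next
    fix p and F :: "(unit \<Rightarrow> 'g) \<Rightarrow> real" assume F: "\<And>y. \<bar>F y\<bar> \<le> 1"
    show "\<bar>D p F\<bar> \<le> (\<Sum>g\<in>UNIV. \<bar>l g - l' g\<bar>)"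
      unfolding D_def
      by (intro order_trans[OF sum_abs] sum_mono) (simp add: abs_mult mult_left_le F)
  qed (auto simp: D_def inj_on_def distrib_left sum.distrib sum_distrib_left mult.left_commute)
  show ?thesis
  proof
    fix h
    have "D (\<lambda>_. 0) (\<lambda>y. indicator {h} (y ())) = 0"
      by (rule D_vanishes[OF ap, where b = 1]) (auto simp: depends_on_def indicator_def)
    then show "l h = l' h" by (simp add: D_def indicator_def)
  qed
qed

text \<open>The law is compared with itself under the shift \<open>m - n\<close>.\<close>

lemma marginal_stationary:
  assumes comp: "compatible p_ker \<mu>" and ap: "aperiodic_sf A P"
  shows "measure \<mu> {x. x n = g} = measure \<mu> {x. x m = g}"
proof -
  have "{x. x n = g} \<in> sets \<mu>" for n
    using coordinate_in_path_space compatible_sets[OF comp] by simp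
  moreover have "expect \<mu> (\<lambda>_ :: unit. n) (\<lambda>y. indicator {g} (y ()))
      = expect \<mu> (\<lambda>_. n + (m - n)) (\<lambda>y. indicator {g} (y ()))"
    by (rule expect_unique[OF comp comp ap, of UNIV]) (auto simp: depends_on_def)
  moreover have "expect \<mu> (\<lambda>_ :: unit. n) (\<lambda>y. indicator {g} (y ()))
      = (\<integral>x. indicator {x. x n = g} x \<partial>\<mu>)" for n
    unfolding expect_def by (intro Bochner_Integration.integral_cong) (auto simp: indicator_def)
  ultimately show ?thesis by simp
qed

text \<open>Testing compatibility with the constant 1 expresses the marginal at \<open>n\<close>
  through those at \<open>n - k\<close>; stationarity replaces all of them by the marginal at
  \<open>n\<close>.\<close>

lemma marginal_invariant:
  assumes comp: "compatible p_ker \<mu>" and ap: "aperiodic_sf A P"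
  shows "invariant_distr (avg_mat A \<theta> P) (\<lambda>g. measure \<mu> {x. x n = g})"
  unfolding invariant_distr_def
proof (intro conjI allI)
  note \<mu> = compatible_prob_space[OF comp] compatible_sets[OF comp]
  interpret prob_space \<mu> by (rule \<mu>(1))
  have meas: "{x. x m = g} \<in> sets \<mu>" for m g using coordinate_in_path_space \<mu>(2) by simp
  let ?l = "\<lambda>g. measure \<mu> {x. x n = g}"
  \<comment> \<open>The weights are those of site \<open>n\<close>, although \<open>f\<close> is
    evaluated at an arbitrary site \<open>m\<close>.\<close>
  have int_val: "(\<integral>x. f (x m) \<partial>\<mu>) = (\<Sum>i\<in>UNIV. ?l i * f i)" for f :: "'g \<Rightarrow> real" and m
  proof -
    have "(\<integral>x. f (x m) \<partial>\<mu>) = (\<integral>x. (\<Sum>i\<in>UNIV. indicator {x. x m = i} x * f i) \<partial>\<mu>)"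
      by (intro Bochner_Integration.integral_cong refl)
         (simp add: indicator_def if_distrib[of "\<lambda>c. c * _"] cong: if_cong)
    also have "\<dots> = (\<Sum>i\<in>UNIV. \<integral>x. indicator {x. x m = i} x * f i \<partial>\<mu>)"
      by (intro Bochner_Integration.integral_sum integrable_mult_left)
         (simp add: meas emeasure_eq_measure)
    also have "\<dots> = (\<Sum>i\<in>UNIV. ?l i * f i)"
      using meas marginal_stationary[OF comp ap, of n _ m] by simp
    finally show ?thesis .
  qed
  show "0 \<le> ?l i" for i by simp
  show "(\<Sum>i\<in>UNIV. ?l i) = 1" using int_val[of "\<lambda>_. 1" n] by (simp add: prob_space)
  fix j
  have "((\<lambda>k. \<theta> k * (\<integral>x. 1 * P k (x (n - int k)) j \<partial>\<mu>)) has_sum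
      (\<integral>x. 1 * indicator {x. x n = j} x \<partial>\<mu>)) A"
    by (rule compatible_step[OF comp, of "{}" _ _ 1]) (auto simp: depends_on_def)
  then have "((\<lambda>k. \<theta> k * (\<Sum>i\<in>UNIV. ?l i * P k i j)) has_sum ?l j) A"
    using int_val[of "\<lambda>i. P _ i j"] meas by simp
  moreover have "((\<lambda>k. \<Sum>i\<in>UNIV. ?l i * (\<theta> k * P k i j)) has_sum (\<Sum>i\<in>UNIV. ?l i * avg_mat A \<theta> P i j)) A"
    by (intro has_sum_sum has_sum_cmult_right avg_mat_has_sum)
  ultimately show "(\<Sum>i\<in>UNIV. ?l i * avg_mat A \<theta> P i j) = ?l j"
    using has_sum_unique by (fastforce simp: sum_distrib_left mult.left_commute)
qed

end

theorem mainTheorem8: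
  fixes A :: "nat set" and \<theta> :: "nat \<Rightarrow> real"
    and P :: "nat \<Rightarrow> 'g::finite \<Rightarrow> 'g \<Rightarrow> real"
  assumes A_pos: "0 \<notin> A"
    and theta_pos: "\<forall>k\<in>A. \<theta> k > 0"
    and theta_prob: "(\<theta> has_sum 1) A"
    and stoch: "\<forall>k\<in>A. stochastic (P k)"
    and gcdA: "Gcd A = 1"
    and aper: "aperiodic_sf A P"
  shows "(\<exists>!\<mu>. compatible (imitation_kernel A \<theta> P) \<mu>) \<and>
         (\<exists>l. invariant_distr (avg_mat A \<theta> P) l \<and>
              (\<forall>l'. invariant_distr (avg_mat A \<theta> P) l' \<longrightarrow> l' = l) \<and>
              (\<forall>\<mu>. compatible (imitation_kernel A \<theta> P) \<mu> \<longrightarrow>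
                 (\<forall>n g. measure \<mu> {x. x n = g} = l g)))"
proof -
  interpret imitation A \<theta> P by unfold_locales fact+
  obtain \<mu> where \<mu>: "compatible p_ker \<mu>" using compatible_exists by blast
  have unique: "\<nu> = \<mu>" if "compatible p_ker \<nu>" for \<nu>
    using compatible_unique[OF that \<mu> aper] .
  \<comment> \<open>The marginal at time 0 also settles the existence of an invariant
    distribution.\<close>
  define l where "l g = measure \<mu> {x. x 0 = g}" for g
  have l: "invariant_distr (avg_mat A \<theta> P) l"
    unfolding l_def by (rule marginal_invariant[OF \<mu> aper])
  have "\<exists>!\<mu>. compatible p_ker \<mu>" using \<mu> unique by blast
  moreover have "l' = l" if "invariant_distr (avg_mat A \<theta> P) l'" for l'
    using invariant_distr_unique[OF aper that l] .
  moreover have "measure \<nu> {x. x n = g} = l g" if "compatible p_ker \<nu>" for \<nu> n g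
    unfolding l_def using unique[OF that] marginal_stationary[OF \<mu> aper, of n g 0] by simp
  ultimately show ?thesis using l by blast
qed

end
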